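(* Let $f:X\to Y$ be a map of a finite simplicial complex $X$ of $\dim X=n$ which admits a partition $X=V_1^0\cup\dots\cup V_k^0$ into $k$ $f$-categorical subcomplexes. Then $X$ admits a partition $X=P_1\cup\dots\cup P_k$ into $f$-categorical subcomplexes with respect to some subdivision of $X$ such that each complex $P_i$ admits a deformation retraction onto an $(n-k+1)$-dimensional subcomplex.
   Context: Maps are continuous. For a map $f:X\to Y$, a set $A\subset X$ is called $f$-categorical if the restriction $f|_A:A\to Y$ is null-homotopic. A union $X_1\cup\dots\cup X_k=X$ is called a partition of $X$ if $\mathrm{Int}\,X_i\cap\mathrm{Int}\,X_j=\emptyset$ for $i\ne j$ and the closure of $\mathrm{Int}\,X_i$ equals $X_i$ for all $i$.
   Formalization: Two hypotheses are added, without which the statement is false: k ≤ n+1 (so that n−k+1 is not negative), and f(X) lies in a single path component of Y (automatic if X is connected or Y is path connected). *)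

theory Defs
  imports "HOL-Analysis.Analysis"
begin

text \<open>
  A finite simplicial complex is a family of simplices in a Euclidean space satisfying
  \<^const>\<open>simplicial_complex\<close> (finiteness is part of that predicate); its underlying space is the
  union of the family, with the subspace topology. The library counts the empty set as a simplex
  (of dimension -1), so a complex may or may not contain it.
\<close>

definition subcomplex :: "'a::euclidean_space set set \<Rightarrow> 'a set set \<Rightarrow> bool" where
  "subcomplex L K \<longleftrightarrow> simplicial_complex L \<and> L \<subseteq> K"

definition subdivision :: "'a::euclidean_space set set \<Rightarrow> 'a set set \<Rightarrow> bool" where
  "subdivision L K \<longleftrightarrow>
     simplicial_complex L \<and> \<Union>L = \<Union>K \<and> (\<forall>S\<in>L. \<exists>T\<in>K. S \<subseteq> T)"

text \<open>The largest dimension of a simplex; -1 for the empty complex.\<close>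

definition complex_dim :: "'a::euclidean_space set set \<Rightarrow> int" where
  "complex_dim K = Max (insert (-1) (aff_dim ` K))"

definition null_homotopic :: "'a topology \<Rightarrow> 'b topology \<Rightarrow> ('a \<Rightarrow> 'b) \<Rightarrow> bool" where
  "null_homotopic X Y g \<longleftrightarrow> (\<exists>c. homotopic_with (\<lambda>_. True) X Y g (\<lambda>_. c))"

definition categorical_set ::
    "'a topology \<Rightarrow> 'b topology \<Rightarrow> ('a \<Rightarrow> 'b) \<Rightarrow> 'a set \<Rightarrow> bool" where
  "categorical_set X Y f A \<longleftrightarrow> A \<subseteq> topspace X \<and> null_homotopic (subtopology X A) Y f"

text \<open>
  A partition is an indexed family: its members may coincide only if they have empty interior,
  and hence are empty.
\<close>

definition is_partition :: "'a topology \<Rightarrow> 'i set \<Rightarrow> ('i \<Rightarrow> 'a set) \<Rightarrow> bool" where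
  "is_partition X I A \<longleftrightarrow>
     (\<Union>i\<in>I. A i) = topspace X \<and>
     (\<forall>i\<in>I. \<forall>j\<in>I. i \<noteq> j \<longrightarrow> X interior_of (A i) \<inter> X interior_of (A j) = {}) \<and>
     (\<forall>i\<in>I. X closure_of (X interior_of (A i)) = A i)"

text \<open>
  Deformation retraction in the strong sense: the homotopy from the identity to the retraction is
  stationary on the retract.
\<close>

definition deformation_retracts_onto ::
    "'a::topological_space set \<Rightarrow> 'a set \<Rightarrow> bool" where
  "deformation_retracts_onto S T \<longleftrightarrow>
     (\<exists>r. retraction S T r \<and> homotopic_with_canon (\<lambda>h. \<forall>x\<in>T. h x = x) S S id r)"

end

theory Submission
  imports Defs
begin

text \<open>
  Colour the vertices of a complex and let \<open>P\<^sub>i\<close> be the set of points at which the largest barycentric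
  coordinate is attained at a vertex of colour \<open>i\<close>. The \<open>P\<^sub>i\<close> form a partition into subcomplexes of the
  barycentric subdivision, and \<open>P\<^sub>i\<close> retracts linearly onto the full subcomplex spanned by the vertices
  of colour \<open>i\<close>. So it suffices to colour the vertices of a barycentric subdivision, that is, the
  simplices \<open>S\<close> of a complex, such that the full subcomplexes are \<open>f\<close>-categorical of dimension
  \<open>m = n - k + 1\<close>.

  Let \<open>J S\<close> be the least \<open>j\<close> with \<open>S\<close> contained in \<open>V\<^sub>j\<close>; it is monotone in \<open>S\<close>. The colour of \<open>S\<close> is
  \<open>J S\<close> clamped to the interval \<open>[d + 1 - m, d + 1]\<close>, where \<open>d\<close> is the dimension of \<open>S\<close>. A colour occurs
  in at most \<open>m + 1\<close> dimensions, which bounds the dimension of the full subcomplexes, and if \<open>S\<close> is a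
  proper face of \<open>T\<close> of the same colour, then \<open>J S = J T\<close>: the window moves up with the dimension, so a
  larger label cannot be clamped to the same colour. Hence the full subcomplex of one colour is
  the disjoint union of closed pieces on which \<open>J\<close> is constant, each inside one \<open>V\<^sub>j\<close>. To attain the
  dimension \<open>m\<close> exactly, the labels are changed near a simplex in the interior of an
  \<open>n\<close>-dimensional one.
\<close>

section \<open>Vertex schemes of simplicial complexes\<close>

lemma affine_independent_unique:
  fixes A :: "'a::real_vector set"
  assumes "finite A" "\<not> affine_dependent A" "sum u A = sum w A"
    "(\<Sum>v\<in>A. u v *\<^sub>R v) = (\<Sum>v\<in>A. w v *\<^sub>R v)" "v \<in> A"
  shows "u v = w v"
proof (rule ccontr)
  assume "u v \<noteq> w v"
  then have "\<exists>U. sum U A = 0 \<and> (\<exists>v\<in>A. U v \<noteq> 0) \<and> (\<Sum>v\<in>A. U v *\<^sub>R v) = 0"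
    using assms
    by (intro exI[of _ "\<lambda>v. u v - w v"]) (auto simp: sum_subtractf algebra_simps)
  then show False
    using assms affine_dependent_explicit_finite by blast
qed

text \<open>The differences \<open>w - v\<close> are linearly independent, so some linear
  \<open>g\<close> takes the value -1 on all of them. The shift \<open>1 - g v\<close> then makes
  the barycentric coordinate of \<open>v\<close> an affine function on the whole space.\<close>

lemma affine_coordinate:
  fixes A :: "'a::euclidean_space set"
  assumes "\<not> affine_dependent A" "v \<in> A"
  shows "\<exists>(g :: 'a \<Rightarrow> real) c. linear g \<and> (\<forall>w\<in>A. g w + c = (if w = v then 1 else 0))"
proof -
  have "independent ((\<lambda>x. - v + x) ` (A - {v}))"
    using affine_dependent_iff_dependent2 assms by blast
  then obtain g :: "'a \<Rightarrow> real"
    where g: "linear g" "\<forall>x\<in>(\<lambda>x. - v + x) ` (A - {v}). g x = - 1"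
    using linear_independent_extend[of _ "\<lambda>x. - 1"] by blast
  have "g w + (1 - g v) = (if w = v then 1 else 0)" if "w \<in> A" for w
  proof (cases "w = v")
    case False
    then have "g (- v + w) = - 1"
      using g that by blast
    then have "g w - g v = - 1"
      using linear_diff[OF g(1)] by (metis uminus_add_conv_diff)
    then show ?thesis
      using False by simp
  qed simp
  then show ?thesis
    using g(1) by blast
qed

text \<open>A geometric complex given by the vertex sets of its nonempty simplices, so that faces
  are subsets and subdivision is a matter of chains. \<open>hull_Int\<close> carries the geometry:
  two simplices meet only in the simplex on their common vertices.\<close>

locale vertex_scheme =
  fixes F :: "'a::euclidean_space set set"
  assumes finite_scheme: "finite F"
    and nonempty: "A \<in> F \<Longrightarrow> A \<noteq> {}"
    and affine_independent: "A \<in> F \<Longrightarrow> \<not> affine_dependent A"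
    and subset_closed: "A \<in> F \<Longrightarrow> B \<subseteq> A \<Longrightarrow> B \<noteq> {} \<Longrightarrow> B \<in> F"
    and hull_Int: "A \<in> F \<Longrightarrow> B \<in> F \<Longrightarrow> convex hull A \<inter> convex hull B \<subseteq> convex hull (A \<inter> B)"

definition realization :: "'a::euclidean_space set set \<Rightarrow> 'a set" where
  "realization F = (\<Union>A\<in>F. convex hull A)"

text \<open>\<open>simplicial_complex\<close> asks for closure under faces, and the empty set is a
  face of every simplex; hence the inserted \<open>{}\<close>.\<close>

definition complex_of :: "'a::euclidean_space set set \<Rightarrow> 'a set set" where
  "complex_of F = insert {} ((hull) convex ` F)"

definition scheme_of :: "'a::euclidean_space set set \<Rightarrow> 'a set set" where
  "scheme_of K = {A. A \<noteq> {} \<and> \<not> affine_dependent A \<and> convex hull A \<in> K}"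

text \<open>Barycentric coordinates as functions on the whole type. The support condition selects
  the open simplex and forces the value 0 off the vertices.\<close>

definition weights :: "'a set set \<Rightarrow> ('a \<Rightarrow> real) set" where
  "weights F = {u. (\<forall>v. 0 \<le> u v) \<and> {v. u v \<noteq> 0} \<in> F \<and> sum u (\<Union>F) = 1}"

definition point :: "'a::real_vector set set \<Rightarrow> ('a \<Rightarrow> real) \<Rightarrow> 'a" where
  "point F u = (\<Sum>v\<in>\<Union>F. u v *\<^sub>R v)"

lemma Union_complex_of: "\<Union>(complex_of F) = realization F"
  by (auto simp: complex_of_def realization_def)

lemma complex_of_mono: "G \<subseteq> F \<Longrightarrow> complex_of G \<subseteq> complex_of F"
  by (auto simp: complex_of_def)

context vertex_scheme
begin

lemma finite_member: "A \<in> F \<Longrightarrow> finite A"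
  using affine_independent aff_independent_finite by blast

lemma finite_vertices: "finite (\<Union>F)"
  using finite_scheme finite_member by blast

lemma subscheme:
  assumes "G \<subseteq> F" "\<And>A B. A \<in> G \<Longrightarrow> B \<subseteq> A \<Longrightarrow> B \<noteq> {} \<Longrightarrow> B \<in> G"
  shows "vertex_scheme G"
proof
  show "finite G"
    using assms(1) finite_scheme finite_subset by blast
  show "A \<noteq> {}" "\<not> affine_dependent A" if "A \<in> G" for A
    using that assms(1) nonempty affine_independent by auto
  show "B \<in> G" if "A \<in> G" "B \<subseteq> A" "B \<noteq> {}" for A B
    using that assms(2) by blast
  show "convex hull A \<inter> convex hull B \<subseteq> convex hull (A \<inter> B)" if "A \<in> G" "B \<in> G" for A B
    using that assms(1) by (intro hull_Int) auto
qed

text \<open>Faces of the hull of an affinely independent set are the hulls of its subsets, so both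
  face axioms reduce to \<open>subset_closed\<close> and \<open>hull_Int\<close>.\<close>

lemma simplicial_complex: "simplicial_complex (complex_of F)"
  unfolding simplicial_complex_def
proof (intro conjI ballI allI impI)
  show "finite (complex_of F)"
    using finite_scheme by (simp add: complex_of_def)
  show "\<exists>n. n simplex S" if S: "S \<in> complex_of F" for S
  proof (cases "S = {}")
    case True
    then have "(-1) simplex S"
      by simp
    then show ?thesis ..
  next
    case False
    then obtain A where "A \<in> F" "S = convex hull A"
      using S by (auto simp: complex_of_def)
    then have "(int (card A) - 1) simplex S"
      unfolding simplex_def using affine_independent by auto
    then show ?thesis ..
  qed
  show "T \<in> complex_of F" if S: "S \<in> complex_of F \<and> T face_of S" for T S
  proof (cases "T = {}")
    case True
    then show ?thesis by (simp add: complex_of_def)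
  next
    case False
    then have "S \<noteq> {}"
      using S face_of_imp_subset by blast
    then obtain A where A: "A \<in> F" "S = convex hull A"
      using S by (auto simp: complex_of_def)
    then obtain B where "B \<subseteq> A" "T = convex hull B"
      using S face_of_convex_hull_affine_independent[OF affine_independent] by blast
    moreover have "B \<noteq> {}"
      using False calculation by auto
    ultimately show ?thesis
      using A subset_closed by (auto simp: complex_of_def)
  qed
  show "(S \<inter> T) face_of S" if ST: "S \<in> complex_of F \<and> T \<in> complex_of F" for S T
  proof (cases "S = {} \<or> T = {}")
    case False
    then obtain A B where AB: "A \<in> F" "S = convex hull A" "B \<in> F" "T = convex hull B"
      using ST by (auto simp: complex_of_def)
    then have "S \<inter> T = convex hull (A \<inter> B)"
      using hull_Int by (metis Int_greatest hull_mono inf_le1 inf_le2 subset_antisym)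
    then show ?thesis
      using AB face_of_convex_hull_affine_independent[OF affine_independent] by blast
  qed auto
qed

lemma hull_eq_point:
  assumes "A \<in> F"
  shows "convex hull A = point F ` {u \<in> weights F. {v. u v \<noteq> 0} \<subseteq> A}"
proof -
  have A: "finite A" "A \<subseteq> \<Union>F"
    using assms finite_member by auto
  have sums: "sum u (\<Union>F) = sum u A" "point F u = (\<Sum>v\<in>A. u v *\<^sub>R v)"
    if "{v. u v \<noteq> 0} \<subseteq> A" for u
    unfolding point_def using that A finite_vertices by (auto intro!: sum.mono_neutral_right)
  show ?thesis
  proof (intro equalityI subsetI)
    fix x assume "x \<in> convex hull A"
    then obtain u where u: "\<forall>v\<in>A. 0 \<le> u v" "sum u A = 1" "(\<Sum>v\<in>A. u v *\<^sub>R v) = x"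
      using A by (auto simp: convex_hull_finite)
    define w where "w v = (if v \<in> A then u v else 0)" for v
    have w: "sum w A = 1" "(\<Sum>v\<in>A. w v *\<^sub>R v) = x" "\<forall>v. 0 \<le> w v" "{v. w v \<noteq> 0} \<subseteq> A"
      using u by (auto simp: w_def)
    moreover have "{v. w v \<noteq> 0} \<noteq> {}"
    proof
      assume "{v. w v \<noteq> 0} = {}"
      then have "sum w A = 0"
        by (intro sum.neutral) blast
      then show False
        using w(1) by simp
    qed
    ultimately have "w \<in> weights F"
      using subset_closed[OF assms] sums(1)[of w] by (simp add: weights_def)
    then show "x \<in> point F ` {u \<in> weights F. {v. u v \<noteq> 0} \<subseteq> A}"
      using w sums(2)[of w] by (intro image_eqI[of _ _ w]) auto
  next
    fix x assume "x \<in> point F ` {u \<in> weights F. {v. u v \<noteq> 0} \<subseteq> A}"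
    then obtain u where u: "u \<in> weights F" "{v. u v \<noteq> 0} \<subseteq> A" "x = point F u"
      by blast
    then show "x \<in> convex hull A"
      using sums[of u] A(1) by (auto simp: convex_hull_finite weights_def)
  qed
qed

lemma realization_eq_point: "realization F = point F ` weights F"
proof -
  have "(\<Union>A\<in>F. {u \<in> weights F. {v. u v \<noteq> 0} \<subseteq> A}) = weights F"
    by (auto simp: weights_def)
  then show ?thesis
    unfolding realization_def by (simp add: hull_eq_point flip: image_UN)
qed

lemma point_in_hull:
  assumes "u \<in> weights F"
  shows "point F u \<in> convex hull {v. u v \<noteq> 0}"
  using assms hull_eq_point[of "{v. u v \<noteq> 0}"] by (auto simp: weights_def)

lemma weights_zero:
  assumes "u \<in> weights F" "v \<notin> \<Union>F"
  shows "u v = 0"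
  using assms by (auto simp: weights_def)

text \<open>A common image lies in the hull of the common support. Coordinates \<open>w\<close> of
  it supported there agree with \<open>u\<close> and with \<open>u'\<close>, since each support is
  affinely independent.\<close>

lemma inj_on_point: "inj_on (point F) (weights F)"
proof (rule inj_onI)
  fix u u' assume u: "u \<in> weights F" "u' \<in> weights F" and eq: "point F u = point F u'"
  let ?A = "{v. u v \<noteq> 0}" and ?B = "{v. u' v \<noteq> 0}"
  have AB: "?A \<in> F" "?B \<in> F"
    using u by (auto simp: weights_def)
  have x: "point F u \<in> convex hull (?A \<inter> ?B)"
    using point_in_hull[OF u(1)] point_in_hull[OF u(2)] eq hull_Int[OF AB] by auto
  then have "?A \<inter> ?B \<noteq> {}"
    by auto
  then have "?A \<inter> ?B \<in> F"
    by (rule subset_closed[OF AB(1) Int_lower1])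
  then obtain w where w: "w \<in> weights F" "{v. w v \<noteq> 0} \<subseteq> ?A \<inter> ?B" "point F w = point F u"
    using x hull_eq_point by auto
  have *: "w = u" if "u \<in> weights F" "{v. w v \<noteq> 0} \<subseteq> {v. u v \<noteq> 0}" "point F w = point F u" for u
  proof
    fix v
    let ?A = "{v. u v \<noteq> 0}"
    have A: "?A \<in> F"
      using that by (auto simp: weights_def)
    have "sum f (\<Union>F) = sum f ?A" if "{v. f v \<noteq> 0} \<subseteq> ?A" for f :: "'a \<Rightarrow> real"
      using that A finite_vertices by (intro sum.mono_neutral_right) auto
    moreover have "sum (\<lambda>v. f v *\<^sub>R v) (\<Union>F) = sum (\<lambda>v. f v *\<^sub>R v) ?A"
      if "{v. f v \<noteq> 0} \<subseteq> ?A" for f :: "'a \<Rightarrow> real"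
      using that A finite_vertices by (intro sum.mono_neutral_right) auto
    ultimately have "sum w ?A = sum u ?A" "(\<Sum>v\<in>?A. w v *\<^sub>R v) = (\<Sum>v\<in>?A. u v *\<^sub>R v)"
      using that w(1) by (auto simp: weights_def point_def)
    then show "w v = u v"
      using affine_independent_unique[of ?A w u v] A finite_member affine_independent that(2)
      by (cases "u v = 0") auto
  qed
  show "u = u'"
    using *[of u] *[of u'] u w eq by simp
qed

end

section \<open>The vertex scheme of a given complex\<close>

context
  fixes K :: "'a::euclidean_space set set"
  assumes K: "simplicial_complex K"
begin

text \<open>The vertices of a simplex are the extreme points of its hull and so are determined by
  it. This gives finiteness, and it shows that the intersection of two simplices is spanned by
  common vertices.\<close>

lemma vertex_scheme_scheme_of: "vertex_scheme (scheme_of K)"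
proof
  have inj: "inj_on ((hull) convex) (scheme_of K)"
  proof (rule inj_onI)
    fix A B :: "'a set"
    assume AB: "A \<in> scheme_of K" "B \<in> scheme_of K" and "convex hull A = convex hull B"
    then have "x \<in> A \<longleftrightarrow> x \<in> B" for x
      using extreme_point_of_convex_hull_affine_independent[of A x]
        extreme_point_of_convex_hull_affine_independent[of B x]
      by (simp add: scheme_of_def)
    then show "A = B" by blast
  qed
  have "(hull) convex ` scheme_of K \<subseteq> K"
    by (auto simp: scheme_of_def)
  then show "finite (scheme_of K)"
    using K by (metis finite_imageD[OF _ inj] finite_subset simplicial_complex_def)
  show "A \<noteq> {}" "\<not> affine_dependent A" if "A \<in> scheme_of K" for A
    using that by (auto simp: scheme_of_def)
  show "B \<in> scheme_of K" if "A \<in> scheme_of K" "B \<subseteq> A" "B \<noteq> {}" for A B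
  proof -
    have "convex hull B face_of convex hull A"
      using that face_of_convex_hull_affine_independent[of A] by (auto simp: scheme_of_def)
    then have "convex hull B \<in> K"
      using K that by (auto simp: simplicial_complex_def scheme_of_def)
    then show ?thesis
      using that affine_independent_subset by (auto simp: scheme_of_def)
  qed
  show "convex hull A \<inter> convex hull B \<subseteq> convex hull (A \<inter> B)"
    if A: "A \<in> scheme_of K" and B: "B \<in> scheme_of K" for A B
  proof -
    have "(convex hull A \<inter> convex hull B) face_of convex hull A"
      "(convex hull A \<inter> convex hull B) face_of convex hull B"
      using A B K unfolding simplicial_complex_def scheme_of_def
      by (blast, metis (no_types, lifting) inf_commute mem_Collect_eq)
    then obtain C D where C: "C \<subseteq> A" "convex hull A \<inter> convex hull B = convex hull C"
      and D: "D \<subseteq> B" "convex hull A \<inter> convex hull B = convex hull D"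
      using A B face_of_convex_hull_affine_independent by (metis (no_types, lifting) mem_Collect_eq scheme_of_def)
    have "\<not> affine_dependent C" "\<not> affine_dependent D"
      using A B affine_independent_subset[OF _ C(1)] affine_independent_subset[OF _ D(1)]
      by (auto simp: scheme_of_def)
    then have "x \<in> C \<longleftrightarrow> x \<in> D" for x
      using extreme_point_of_convex_hull_affine_independent[of C x]
        extreme_point_of_convex_hull_affine_independent[of D x] C D by simp
    then have "C \<subseteq> A \<inter> B"
      using C D by blast
    then show ?thesis
      using C hull_mono by metis
  qed
qed

lemma mem_complex_iff: "S \<in> K \<and> S \<noteq> {} \<longleftrightarrow> (\<exists>A\<in>scheme_of K. S = convex hull A)"
proof
  assume S: "S \<in> K \<and> S \<noteq> {}"
  then obtain n where "n simplex S"
    using K unfolding simplicial_complex_def by blast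
  then obtain A where "\<not> affine_dependent A" "S = convex hull A"
    by (auto simp: simplex_def)
  then show "\<exists>A\<in>scheme_of K. S = convex hull A"
    using S by (auto simp: scheme_of_def)
next
  assume "\<exists>A\<in>scheme_of K. S = convex hull A"
  then show "S \<in> K \<and> S \<noteq> {}"
    by (auto simp: scheme_of_def)
qed

lemma realization_scheme_of: "realization (scheme_of K) = \<Union>K"
proof -
  have "\<Union>K = \<Union>{S. S \<in> K \<and> S \<noteq> {}}"
    by blast
  also have "\<dots> = realization (scheme_of K)"
    unfolding mem_complex_iff realization_def by blast
  finally show ?thesis ..
qed

end

section \<open>Barycentric subdivision\<close>

definition barycenter :: "'a::real_vector set \<Rightarrow> 'a" where
  "barycenter S = (\<Sum>v\<in>S. v) /\<^sub>R real (card S)"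

text \<open>The order complex of the face poset, placed in the same space by barycenters. It is
  again a family of vertex sets, so the operation can be iterated.\<close>

definition sd :: "'a::euclidean_space set set \<Rightarrow> 'a set set" where
  "sd F = {barycenter ` C | C. C \<noteq> {} \<and> subset.chain F C}"

text \<open>The coordinates, with respect to the original vertices, of the combination of the
  barycenters of \<open>C\<close> with coefficients \<open>t\<close>.\<close>

definition chain_weights :: "'a set set \<Rightarrow> ('a set \<Rightarrow> real) \<Rightarrow> 'a \<Rightarrow> real" where
  "chain_weights C t v = (\<Sum>S\<in>C. if v \<in> S then t S / real (card S) else 0)"

text \<open>The value at \<open>v\<close> is a sum over the members of the chain containing
  \<open>v\<close>, and these families \<open>up v\<close> are nested. The superlevel set is the
  least member of the smallest \<open>up v\<close> whose sum still exceeds \<open>s\<close>.\<close>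

lemma chain_weights_superlevel:
  assumes C: "finite C" "subset.chain F C" and t: "\<And>S. S \<in> C \<Longrightarrow> 0 \<le> t S" and "0 \<le> s"
  shows "{v. s < chain_weights C t v} \<in> insert {} C"
proof (cases "{v. s < chain_weights C t v} = {}")
  case False
  define up where "up v = {S \<in> C. v \<in> S}" for v
  have up_chain: "up v \<subseteq> up w \<or> up w \<subseteq> up v" for v w
  proof (rule ccontr)
    assume "\<not> ?thesis"
    then obtain S T where ST: "S \<in> C" "v \<in> S" "w \<notin> S" "T \<in> C" "w \<in> T" "v \<notin> T"
      by (auto simp: up_def)
    then have "S \<subseteq> T \<or> T \<subseteq> S"
      using C by (auto simp: subset_chain_def)
    then show False
      using ST by blast
  qed
  have cw: "chain_weights C t v = (\<Sum>S\<in>up v. t S / real (card S))" for v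
    using C(1) by (simp add: chain_weights_def up_def sum.inter_filter)
  have mono: "chain_weights C t v \<le> chain_weights C t w" if "up v \<subseteq> up w" for v w
    unfolding cw using that C(1) t by (intro sum_mono2) (auto simp: up_def)
  obtain v where v: "s < chain_weights C t v"
    and min: "\<And>w. s < chain_weights C t w \<Longrightarrow> card (up v) \<le> card (up w)"
    using False arg_min_nat_lemma[of "\<lambda>v. s < chain_weights C t v" _ "\<lambda>v. card (up v)"]
    by blast
  have up_v: "up v \<subseteq> up w" if "s < chain_weights C t w" for w
    using up_chain[of v w] min[OF that] C(1)
    by (metis card_seteq finite_subset mem_Collect_eq subsetI up_def)
  have "up v \<noteq> {}"
    using v \<open>0 \<le> s\<close> by (auto simp: cw)
  moreover have "finite (up v)" "subset.chain F (up v)"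
    using C by (auto simp: up_def subset_chain_def)
  ultimately have "\<Inter>(up v) \<in> up v"
    using Inter_in_chain by blast
  moreover have "{v. s < chain_weights C t v} = \<Inter>(up v)"
  proof (intro equalityI subsetI)
    fix w assume "w \<in> \<Inter>(up v)"
    then have "up v \<subseteq> up w"
      by (auto simp: up_def)
    then show "w \<in> {v. s < chain_weights C t v}"
      using mono[of v w] v by simp
  qed (use up_v in \<open>auto simp: up_def\<close>)
  ultimately show ?thesis
    by (auto simp: up_def)
qed auto

text \<open>Subtract the least positive value on the support and recurse.\<close>

lemma layer_cake:
  fixes g :: "'a \<Rightarrow> real"
  assumes C: "finite C" "\<And>S. S \<in> C \<Longrightarrow> finite S" and g: "\<And>v. 0 \<le> g v"
    and "\<And>s. 0 \<le> s \<Longrightarrow> {v. s < g v} \<in> insert {} C"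
  shows "\<exists>t. (\<forall>S. 0 \<le> t S) \<and> g = chain_weights C t"
  using g assms(4)
proof (induction "card {v. 0 < g v}" arbitrary: g rule: less_induct)
  case less
  let ?A = "{v. 0 < g v}"
  show ?case
  proof (cases "?A = {}")
    case True
    then have "g = (\<lambda>v. 0)"
      using less.prems(1) by (auto simp: fun_eq_iff intro: antisym simp: not_less)
    then show ?thesis
      by (intro exI[of _ "\<lambda>S. 0"]) (simp add: chain_weights_def fun_eq_iff cong: if_cong)
  next
    case False
    then have A: "?A \<in> C" "finite ?A"
      using less.prems(2)[of 0] C(2) by auto
    define m where "m = Min (g ` ?A)"
    have m: "m \<in> g ` ?A" and m_le: "\<And>v. v \<in> ?A \<Longrightarrow> m \<le> g v"
      unfolding m_def using A False by auto
    then have "0 < m"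
      by auto
    define g' where "g' v = (if v \<in> ?A then g v - m else 0)" for v
    obtain a where a: "a \<in> ?A" "g a = m"
      using m by blast
    have "{v. 0 < g' v} \<subset> ?A"
      using a \<open>0 < m\<close> by (auto simp: g'_def)
    then have "card {v. 0 < g' v} < card ?A"
      using A(2) psubset_card_mono by blast
    moreover have "0 \<le> g' v" for v
      using m_le by (auto simp: g'_def)
    moreover have "{v. s < g' v} \<in> insert {} C" if "0 \<le> s" for s
    proof -
      have "{v. s < g' v} = {v. s + m < g v}"
        using that \<open>0 < m\<close> by (auto simp: g'_def)
      then show ?thesis
        using less.prems(2)[of "s + m"] that \<open>0 < m\<close> by auto
    qed
    ultimately obtain t where t: "\<forall>S. 0 \<le> t S" "g' = chain_weights C t"
      using less.hyps[of g'] by blast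
    \<comment> \<open>The factor \<open>card S\<close> cancels the division in
      \<open>chain_weights\<close>, so the new layer adds exactly \<open>m\<close> on the
      support.\<close>
    define t' where "t' S = t S + (if S = ?A then m * real (card S) else 0)" for S
    have "g v = chain_weights C t' v" for v
    proof -
      have "chain_weights C t' v
        = (\<Sum>S\<in>C. (if v \<in> S then t S / real (card S) else 0) + (if S = ?A then (if v \<in> ?A then m else 0) else 0))"
        unfolding chain_weights_def
        using A False by (intro sum.cong) (auto simp: t'_def add_divide_distrib)
      also have "\<dots> = chain_weights C t v + (if v \<in> ?A then m else 0)"
        using A(1) C(1) by (simp add: sum.distrib chain_weights_def)
      also have "\<dots> = g' v + (if v \<in> ?A then m else 0)"
        using t by simp
      also have "\<dots> = g v"
        using less.prems(1)[of v] by (auto simp: g'_def)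
      finally show ?thesis ..
    qed
    moreover have "\<forall>S. 0 \<le> t' S"
      using t \<open>0 < m\<close> by (auto simp: t'_def)
    ultimately show ?thesis
      by blast
  qed
qed

text \<open>The chain whose barycenters span the smallest simplex of the subdivision containing the
  point with coordinates \<open>u\<close>.\<close>

definition superlevels :: "('a \<Rightarrow> real) \<Rightarrow> 'a set set" where
  "superlevels u = {{v. s < u v} | s. 0 \<le> s} - {{}}"

context vertex_scheme
begin

lemma finite_chain: "subset.chain F C \<Longrightarrow> finite C"
  using finite_scheme finite_subset by (auto simp: subset_chain_def)

text \<open>The change of coordinates from the subdivision to \<open>F\<close>, by exchanging the
  sums over chain and vertices. The signs of \<open>t\<close> are arbitrary, because affine
  dependences are fed in as well.\<close>

lemma sum_barycenter:
  assumes "C \<subseteq> F"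
  shows "(\<Sum>S\<in>C. t S *\<^sub>R barycenter S) = point F (chain_weights C t)"
    and "sum (chain_weights C t) (\<Union>F) = sum t C"
proof -
  have S: "S \<subseteq> \<Union>F" "finite S" "S \<noteq> {}" if "S \<in> C" for S
    using that assms nonempty finite_member by auto
  have sum_if: "(\<Sum>v\<in>\<Union>F. if v \<in> S then c else 0) = (\<Sum>v\<in>S. c)" if "S \<in> C" for S and c :: real
    using sum.inter_restrict[OF finite_vertices, of "\<lambda>_. c" S] S(1)[OF that]
    by (simp only: Int_absorb1)
  have "(\<Sum>S\<in>C. t S *\<^sub>R barycenter S)
    = (\<Sum>S\<in>C. \<Sum>v\<in>\<Union>F. (if v \<in> S then t S / real (card S) else 0) *\<^sub>R v)"
  proof (rule sum.cong)
    fix S assume "S \<in> C"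
    have "t S *\<^sub>R barycenter S = (\<Sum>v\<in>S. (t S / real (card S)) *\<^sub>R v)"
      by (simp add: barycenter_def divide_inverse flip: scaleR_sum_right)
    also have "\<dots> = (\<Sum>v\<in>\<Union>F. if v \<in> S then (t S / real (card S)) *\<^sub>R v else 0)"
      using S(1)[OF \<open>S \<in> C\<close>] finite_vertices by (simp add: Int_absorb1 flip: sum.inter_restrict)
    also have "\<dots> = (\<Sum>v\<in>\<Union>F. (if v \<in> S then t S / real (card S) else 0) *\<^sub>R v)"
      by (rule sum.cong) auto
    finally show "t S *\<^sub>R barycenter S = \<dots>" .
  qed simp
  also have "\<dots> = point F (chain_weights C t)"
    unfolding point_def chain_weights_def by (subst sum.swap) (simp add: scaleR_sum_left)
  finally show "(\<Sum>S\<in>C. t S *\<^sub>R barycenter S) = point F (chain_weights C t)" .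
  have "sum (chain_weights C t) (\<Union>F) = (\<Sum>S\<in>C. \<Sum>v\<in>\<Union>F. if v \<in> S then t S / real (card S) else 0)"
    unfolding chain_weights_def by (rule sum.swap)
  also have "\<dots> = (\<Sum>S\<in>C. \<Sum>v\<in>S. t S / real (card S))"
    by (rule sum.cong[OF refl]) (rule sum_if)
  also have "\<dots> = sum t C"
    using S by (intro sum.cong) auto
  finally show "sum (chain_weights C t) (\<Union>F) = sum t C" .
qed

text \<open>The support is the superlevel set at level 0. It is nonempty because the total weight is
  1, so it is a member of the chain.\<close>

lemma chain_weights_in_weights:
  assumes "subset.chain F C" "\<And>S. S \<in> C \<Longrightarrow> 0 \<le> t S" "sum t C = 1"
  shows "chain_weights C t \<in> weights F"
proof -
  have C: "C \<subseteq> F" "finite C"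
    using assms(1) finite_chain by (auto simp: subset_chain_def)
  have nonneg: "0 \<le> chain_weights C t v" for v
    unfolding chain_weights_def using assms(2) by (intro sum_nonneg) auto
  have sum: "sum (chain_weights C t) (\<Union>F) = 1"
    using sum_barycenter(2)[OF C(1)] assms(3) by simp
  have "{v. 0 < chain_weights C t v} \<in> insert {} C"
    using chain_weights_superlevel[OF C(2) assms(1,2), where s = 0] by simp
  moreover have "{v. 0 < chain_weights C t v} = {v. chain_weights C t v \<noteq> 0}"
    using nonneg by (auto simp: less_le)
  moreover have "{v. chain_weights C t v \<noteq> 0} \<noteq> {}"
  proof
    assume "{v. chain_weights C t v \<noteq> 0} = {}"
    then have "sum (chain_weights C t) (\<Union>F) = 0"
      by (intro sum.neutral) blast
    then show False
      using sum by simp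
  qed
  ultimately show ?thesis
    using C(1) sum nonneg by (auto simp: weights_def)
qed

text \<open>The coordinates of the barycenter of \<open>S\<close> have support \<open>S\<close>, and
  coordinates are unique.\<close>

lemma inj_on_barycenter: "inj_on barycenter F"
proof (rule inj_onI)
  fix S T assume ST: "S \<in> F" "T \<in> F" and eq: "barycenter S = barycenter T"
  have w: "chain_weights {S} (\<lambda>_. 1) \<in> weights F" if "S \<in> F" for S
    using that by (intro chain_weights_in_weights) (auto simp: subset_chain_def)
  have p: "point F (chain_weights {S} (\<lambda>_. 1)) = barycenter S" if "S \<in> F" for S
    using sum_barycenter(1)[of "{S}" "\<lambda>_. 1"] that by simp
  have "chain_weights {S} (\<lambda>_. 1) = chain_weights {T} (\<lambda>_. 1)"
    using inj_on_point w p ST eq by (metis inj_onD)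
  moreover have "S = {v. chain_weights {S} (\<lambda>_. 1) v \<noteq> 0}" if "S \<in> F" for S
    using nonempty[OF that] finite_member[OF that] by (auto simp: chain_weights_def)
  ultimately show "S = T"
    using ST by metis
qed

lemma inj_on_barycenter_chain: "subset.chain F C \<Longrightarrow> inj_on barycenter C"
  using inj_on_barycenter inj_on_subset by (auto simp: subset_chain_def)

lemma hull_barycenters:
  assumes C: "subset.chain F C"
  shows "convex hull (barycenter ` C) =
    {point F (chain_weights C t) | t. (\<forall>S\<in>C. 0 \<le> t S) \<and> sum t C = 1}" (is "_ = ?R")
proof -
  have inj: "inj_on barycenter C" and fin: "finite C" and sub: "C \<subseteq> F"
    using C inj_on_barycenter_chain finite_chain by (auto simp: subset_chain_def)
  have "convex hull (barycenter ` C) = {y. \<exists>u. (\<forall>x\<in>barycenter ` C. 0 \<le> u x) \<and>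
      sum u (barycenter ` C) = 1 \<and> (\<Sum>x\<in>barycenter ` C. u x *\<^sub>R x) = y}"
    using fin by (simp add: convex_hull_finite)
  also have "\<dots> = {y. \<exists>u. (\<forall>S\<in>C. 0 \<le> u (barycenter S)) \<and>
      (\<Sum>S\<in>C. u (barycenter S)) = 1 \<and> (\<Sum>S\<in>C. u (barycenter S) *\<^sub>R barycenter S) = y}"
    by (simp add: sum.reindex[OF inj])
  also have "\<dots> = ?R"
  proof (intro equalityI subsetI)
    fix y
    assume "y \<in> {y. \<exists>u. (\<forall>S\<in>C. 0 \<le> u (barycenter S)) \<and>
      (\<Sum>S\<in>C. u (barycenter S)) = 1 \<and> (\<Sum>S\<in>C. u (barycenter S) *\<^sub>R barycenter S) = y}"
    then obtain u where "\<forall>S\<in>C. 0 \<le> u (barycenter S)" "(\<Sum>S\<in>C. u (barycenter S)) = 1"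
      "(\<Sum>S\<in>C. u (barycenter S) *\<^sub>R barycenter S) = y"
      by blast
    then show "y \<in> ?R"
      using sum_barycenter(1)[OF sub, of "\<lambda>S. u (barycenter S)"]
      by (intro CollectI exI[of _ "\<lambda>S. u (barycenter S)"]) simp
  next
    fix y assume "y \<in> ?R"
    then obtain t where t: "\<forall>S\<in>C. 0 \<le> t S" "sum t C = 1" "y = point F (chain_weights C t)"
      by blast
    define u where "u = t \<circ> the_inv_into C barycenter"
    have u: "u (barycenter S) = t S" if "S \<in> C" for S
      using that inj by (simp add: u_def the_inv_into_f_f)
    have "(\<Sum>S\<in>C. u (barycenter S)) = 1" "(\<Sum>S\<in>C. u (barycenter S) *\<^sub>R barycenter S) = y"
      using t u sum_barycenter(1)[OF sub, of t] by simp_all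
    then show "y \<in> {y. \<exists>u. (\<forall>S\<in>C. 0 \<le> u (barycenter S)) \<and>
      (\<Sum>S\<in>C. u (barycenter S)) = 1 \<and> (\<Sum>S\<in>C. u (barycenter S) *\<^sub>R barycenter S) = y}"
      using t(1) u by (intro CollectI exI[of _ u]) simp
  qed
  finally show ?thesis .
qed

text \<open>One direction is \<open>chain_weights_superlevel\<close>, the other
  \<open>layer_cake\<close>. In this form, membership in the simplices of two chains amounts to
  membership in the simplex of their intersection.\<close>

lemma point_in_hull_barycenters_iff:
  assumes C: "subset.chain F C" and u: "u \<in> weights F"
  shows "point F u \<in> convex hull (barycenter ` C) \<longleftrightarrow> (\<forall>s\<ge>0. {v. s < u v} \<in> insert {} C)"
proof
  assume "point F u \<in> convex hull (barycenter ` C)"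
  then obtain t where t: "\<forall>S\<in>C. 0 \<le> t S" "sum t C = 1" "point F u = point F (chain_weights C t)"
    using hull_barycenters[OF C] by auto
  then have "u = chain_weights C t"
    using inj_on_point u chain_weights_in_weights[OF C] by (meson inj_onD)
  then show "\<forall>s\<ge>0. {v. s < u v} \<in> insert {} C"
    using chain_weights_superlevel[OF finite_chain[OF C] C] t(1) by blast
next
  assume *: "\<forall>s\<ge>0. {v. s < u v} \<in> insert {} C"
  have sub: "C \<subseteq> F"
    using C by (auto simp: subset_chain_def)
  then have "\<And>S. S \<in> C \<Longrightarrow> finite S" "\<And>v. 0 \<le> u v"
    using u finite_member by (auto simp: weights_def)
  then obtain t where t: "\<forall>S. 0 \<le> t S" "u = chain_weights C t"
    using layer_cake[of C u] * finite_chain[OF C] by blast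
  then have "sum t C = 1"
    using sum_barycenter(2)[OF sub, of t] u by (auto simp: weights_def)
  then show "point F u \<in> convex hull (barycenter ` C)"
    using hull_barycenters[OF C] t by auto
qed

text \<open>An affine dependence \<open>t\<close> yields coordinates with sum zero that represent
  the zero vector, and these vanish because the top member of the chain is affinely independent.
  Evaluating them at a suitable vertex isolates a single nonzero coefficient.\<close>

lemma affine_independent_barycenters:
  assumes C: "subset.chain F C" "C \<noteq> {}"
  shows "\<not> affine_dependent (barycenter ` C)"
proof
  have inj: "inj_on barycenter C" and fin: "finite C" and sub: "C \<subseteq> F"
    using C inj_on_barycenter_chain finite_chain by (auto simp: subset_chain_def)
  assume "affine_dependent (barycenter ` C)"
  then obtain U where U: "sum U (barycenter ` C) = 0" "\<exists>x\<in>barycenter ` C. U x \<noteq> 0"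
      "(\<Sum>x\<in>barycenter ` C. U x *\<^sub>R x) = 0"
    using affine_dependent_explicit_finite[of "barycenter ` C"] fin by auto
  define t where "t S = U (barycenter S)" for S
  have t: "sum t C = 0" "(\<Sum>S\<in>C. t S *\<^sub>R barycenter S) = 0"
    using U(1,3) by (simp_all add: t_def sum.reindex[OF inj])
  let ?cw = "chain_weights C t"
  have zero: "?cw v = 0" for v
  proof (cases "v \<in> \<Union>C")
    case False
    then show ?thesis
      unfolding chain_weights_def by (intro sum.neutral) auto
  next
    case True
    have top: "\<Union>C \<in> C"
      using Union_in_chain C fin by blast
    then have A: "\<Union>C \<in> F"
      using sub by blast
    have cw0: "?cw v = 0" if "v \<notin> \<Union>C" for v
      using that unfolding chain_weights_def by (intro sum.neutral) auto
    have "sum ?cw (\<Union>C) = sum ?cw (\<Union>F)" "(\<Sum>v\<in>\<Union>C. ?cw v *\<^sub>R v) = point F ?cw"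
      unfolding point_def using finite_vertices A cw0 by (auto intro!: sum.mono_neutral_left)
    then have "sum ?cw (\<Union>C) = 0" "(\<Sum>v\<in>\<Union>C. ?cw v *\<^sub>R v) = 0"
      using sum_barycenter[OF sub, of t] t by simp_all
    then show ?thesis
      using affine_independent_unique[of "\<Union>C" ?cw "\<lambda>_. 0" v] True A
        finite_member affine_independent by simp
  qed
  obtain S0 where "S0 \<in> C" "t S0 \<noteq> 0"
    using U(2) by (auto simp: t_def)
  then obtain S where S: "S \<in> C" "t S \<noteq> 0" and max: "\<And>T. T \<in> C \<Longrightarrow> t T \<noteq> 0 \<Longrightarrow> S \<subseteq> T \<Longrightarrow> S = T"
    using finite_has_maximal[of "{S \<in> C. t S \<noteq> 0}"] fin by auto
  \<comment> \<open>A vertex of \<open>S\<close> outside the largest proper predecessor of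
    \<open>S\<close> in the chain. Among the members containing it only \<open>S\<close> has a
    nonzero coefficient, by maximality.\<close>
  have "\<exists>v\<in>S. \<forall>T\<in>C. v \<in> T \<longrightarrow> S \<subseteq> T"
  proof -
    have S_le: "S \<subseteq> T" if "T \<in> C" "\<not> T \<subset> S" for T
      using that C S(1) unfolding subset_chain_def by blast
    show ?thesis
    proof (cases "{T \<in> C. T \<subset> S} = {}")
      case True
      moreover have "S \<noteq> {}"
        using S(1) sub nonempty by blast
      ultimately show ?thesis
        using S_le by blast
    next
      case False
      have "subset.chain F {T \<in> C. T \<subset> S}"
        using C by (auto simp: subset_chain_def)
      then have "\<Union>{T \<in> C. T \<subset> S} \<in> {T \<in> C. T \<subset> S}"
        using fin by (intro Union_in_chain[OF _ False]) auto
      then obtain v where v: "v \<in> S" "v \<notin> \<Union>{T \<in> C. T \<subset> S}"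
        by blast
      have "S \<subseteq> T" if "T \<in> C" "v \<in> T" for T
        using that v(2) S_le[OF that(1)] by auto
      then show ?thesis
        using v(1) by blast
    qed
  qed
  then obtain v where v: "v \<in> S" "\<And>T. T \<in> C \<Longrightarrow> v \<in> T \<Longrightarrow> S \<subseteq> T"
    by blast
  have "?cw v = (\<Sum>T\<in>C. if T = S then t S / real (card S) else 0)"
    unfolding chain_weights_def
  proof (rule sum.cong[OF refl])
    fix T assume "T \<in> C"
    then show "(if v \<in> T then t T / real (card T) else 0) = (if T = S then t S / real (card S) else 0)"
      using v max[of T] by (cases "t T = 0") auto
  qed
  also have "\<dots> = t S / real (card S)"
    using S fin by simp
  finally have "t S / real (card S) = 0"
    using zero by simp
  then show False
    using S sub finite_member nonempty by (metis card_gt_0_iff divide_eq_0_iff in_mono not_gr_zero of_nat_eq_0_iff)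
qed

text \<open>The condition on intersections comes from the superlevel criterion: a point in the
  simplices of \<open>C\<close> and \<open>D\<close> has all its nonempty superlevel sets in both
  chains, hence in \<open>C \<inter> D\<close>.\<close>

lemma vertex_scheme_sd: "vertex_scheme (sd F)"
proof
  have "sd F \<subseteq> (\<lambda>C. barycenter ` C) ` Pow F"
    by (auto simp: sd_def subset_chain_def)
  then show "finite (sd F)"
    using finite_scheme finite_subset by blast
  show "A \<noteq> {}" "\<not> affine_dependent A" if "A \<in> sd F" for A
    using that affine_independent_barycenters by (auto simp: sd_def)
  show "B \<in> sd F" if A: "A \<in> sd F" and B: "B \<subseteq> A" "B \<noteq> {}" for A B
  proof -
    obtain C where C: "A = barycenter ` C" "subset.chain F C"
      using A by (auto simp: sd_def)
    then obtain D where D: "D \<subseteq> C" "B = barycenter ` D"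
      using B(1) subset_image_iff by metis
    then have "subset.chain F D" "D \<noteq> {}"
      using C B unfolding subset_chain_def by blast+
    then show ?thesis
      using D by (auto simp: sd_def)
  qed
  show "convex hull A \<inter> convex hull B \<subseteq> convex hull (A \<inter> B)" if A: "A \<in> sd F" and B: "B \<in> sd F" for A B
  proof
    fix x assume x: "x \<in> convex hull A \<inter> convex hull B"
    obtain C where C: "A = barycenter ` C" "subset.chain F C"
      using A by (auto simp: sd_def)
    obtain D where D: "B = barycenter ` D" "subset.chain F D"
      using B by (auto simp: sd_def)
    have CD: "subset.chain F (C \<inter> D)"
      using C by (auto simp: subset_chain_def)
    obtain t where t: "\<forall>S\<in>C. 0 \<le> t S" "sum t C = 1" "x = point F (chain_weights C t)"
      using hull_barycenters[OF C(2)] x C(1) by auto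
    define u where "u = chain_weights C t"
    have u: "u \<in> weights F" "x = point F u"
      using t chain_weights_in_weights[OF C(2)] by (auto simp: u_def)
    have "\<forall>s\<ge>0. {v. s < u v} \<in> insert {} (C \<inter> D)"
      using x u point_in_hull_barycenters_iff[OF C(2)] point_in_hull_barycenters_iff[OF D(2)] C(1) D(1)
      by blast
    then have "x \<in> convex hull (barycenter ` (C \<inter> D))"
      using u point_in_hull_barycenters_iff[OF CD] by blast
    moreover have "barycenter ` (C \<inter> D) \<subseteq> A \<inter> B"
      using C D by blast
    ultimately show "x \<in> convex hull (A \<inter> B)"
      using hull_mono by blast
  qed
qed

lemma barycenter_in_hull: "S \<in> F \<Longrightarrow> barycenter S \<in> convex hull S"
  using finite_member[of S] nonempty[of S]
  unfolding convex_hull_finite[OF finite_member] barycenter_def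
  by (intro CollectI exI[of _ "\<lambda>_. inverse (real (card S))"]) (auto simp: scaleR_sum_right)

lemma hull_barycenters_subset:
  assumes "\<And>S. S \<in> C \<Longrightarrow> S \<in> F \<and> S \<subseteq> A"
  shows "convex hull (barycenter ` C) \<subseteq> convex hull A"
proof (rule hull_minimal)
  show "barycenter ` C \<subseteq> convex hull A"
    using assms barycenter_in_hull hull_mono[of _ A convex] by blast
qed (rule convex_convex_hull)

lemma sd_refines:
  assumes "B \<in> sd F"
  obtains A where "A \<in> F" "convex hull B \<subseteq> convex hull A"
proof -
  obtain C where C: "B = barycenter ` C" "subset.chain F C" "C \<noteq> {}"
    using assms by (auto simp: sd_def)
  then have "\<Union>C \<in> F"
    using Union_in_chain[OF finite_chain[OF C(2)] C(3,2)] by (auto simp: subset_chain_def)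
  moreover have "convex hull B \<subseteq> convex hull \<Union>C"
    unfolding C(1) using C(2) by (intro hull_barycenters_subset) (auto simp: subset_chain_def)
  ultimately show thesis
    using that by blast
qed

lemma superlevels:
  assumes "u \<in> weights F"
  shows "subset.chain F (superlevels u)" "superlevels u \<noteq> {}"
    "point F u \<in> convex hull (barycenter ` superlevels u)"
proof -
  have supp: "{v. u v \<noteq> 0} \<in> F" and u: "\<And>v. 0 \<le> u v"
    using assms by (auto simp: weights_def)
  have "X \<in> F" if X: "X \<in> superlevels u" for X
  proof (rule subset_closed[OF supp])
    show "X \<subseteq> {v. u v \<noteq> 0}" "X \<noteq> {}"
      using X by (auto simp: superlevels_def)
  qed
  moreover have "X \<subseteq> Y \<or> Y \<subseteq> X" if XY: "X \<in> superlevels u" "Y \<in> superlevels u" for X Y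
  proof -
    obtain s t where "X = {v. s < u v}" "Y = {v. t < u v}"
      using XY by (auto simp: superlevels_def)
    then show ?thesis
      by (cases "s \<le> t") auto
  qed
  ultimately show chain: "subset.chain F (superlevels u)"
    unfolding subset_chain_def by blast
  have "{v. 0 < u v} = {v. u v \<noteq> 0}"
    using u by (auto simp: less_le)
  then show "superlevels u \<noteq> {}"
    using nonempty[OF supp] unfolding superlevels_def by blast
  show "point F u \<in> convex hull (barycenter ` superlevels u)"
    unfolding point_in_hull_barycenters_iff[OF chain assms] by (auto simp: superlevels_def)
qed

lemma realization_sd: "realization (sd F) = realization F"
proof
  show "realization (sd F) \<subseteq> realization F"
  proof
    fix x assume "x \<in> realization (sd F)"
    then obtain B where B: "B \<in> sd F" "x \<in> convex hull B"
      by (auto simp: realization_def)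
    obtain A where "A \<in> F" "convex hull B \<subseteq> convex hull A"
      using sd_refines[OF B(1)] .
    then show "x \<in> realization F"
      using B(2) by (auto simp: realization_def)
  qed
  show "realization F \<subseteq> realization (sd F)"
  proof
    fix x assume "x \<in> realization F"
    then obtain u where u: "u \<in> weights F" "x = point F u"
      using realization_eq_point by blast
    then have "barycenter ` superlevels u \<in> sd F"
      using superlevels[OF u(1)] by (auto simp: sd_def)
    then show "x \<in> realization (sd F)"
      using superlevels(3)[OF u(1)] u(2) unfolding realization_def by blast
  qed
qed

end

section \<open>Neighbourhoods of full subcomplexes\<close>

text \<open>Remove vertices other than \<open>b\<close> one at a time. Such flags give simplices of
  full dimension in the subdivision; that all members contain \<open>b\<close> matters for finding a
  simplex in the interior.\<close>

lemma flag_exists: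
  assumes "finite S" "b \<in> S"
  shows "\<exists>D. subset.chain {T. b \<in> T \<and> T \<subseteq> S} D \<and> S \<in> D \<and> card D = card S"
  using assms
proof (induction "card S" arbitrary: S)
  case (Suc n)
  show ?case
  proof (cases "S = {b}")
    case True
    then show ?thesis
      by (intro exI[of _ "{{b}}"]) (auto simp: subset_chain_def)
  next
    case False
    then obtain x where x: "x \<in> S" "x \<noteq> b"
      using Suc.prems by blast
    let ?S' = "S - {x}"
    have "n = card ?S'" "finite ?S'" "b \<in> ?S'"
      using Suc x by auto
    then obtain D where D: "subset.chain {T. b \<in> T \<and> T \<subseteq> ?S'} D" "card D = n"
      using Suc.hyps(1)[of ?S'] by auto
    have fin: "finite D"
      using D(1) Suc.prems(1) finite_subset[of D "Pow S"] by (auto simp: subset_chain_def)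
    have "S \<notin> D"
      using D(1) x by (auto simp: subset_chain_def)
    moreover have "subset.chain {T. b \<in> T \<and> T \<subseteq> S} (insert S D)"
      using D(1) Suc.prems(2) unfolding subset_chain_def by blast
    ultimately show ?thesis
      using fin D(2) Suc.hyps(2) by (intro exI[of _ "insert S D"]) auto
  qed
qed auto

definition coord :: "'a::real_vector set set \<Rightarrow> 'a \<Rightarrow> 'a \<Rightarrow> real" where
  "coord F = inv_into (weights F) (point F)"

definition full :: "'a set set \<Rightarrow> 'a set \<Rightarrow> 'a set set" where
  "full F C = {S \<in> F. S \<subseteq> C}"

text \<open>Only used through \<open>sd (meet F C)\<close>, the simplices of \<open>sd F\<close> all
  of whose chain members meet \<open>C\<close>. This is the neighbourhood of the full subcomplex on
  \<open>C\<close>.\<close>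

definition meet :: "'a set set \<Rightarrow> 'a set \<Rightarrow> 'a set set" where
  "meet F C = {S \<in> F. S \<inter> C \<noteq> {}}"

lemma sd_mono: "G \<subseteq> F \<Longrightarrow> sd G \<subseteq> sd F"
  unfolding sd_def subset_chain_def by blast

context vertex_scheme
begin

lemma coord_in_weights: "x \<in> realization F \<Longrightarrow> coord F x \<in> weights F"
  unfolding coord_def realization_eq_point by (rule inv_into_into)

lemma point_coord [simp]: "x \<in> realization F \<Longrightarrow> point F (coord F x) = x"
  using f_inv_into_f[of x "point F" "weights F"] by (simp add: coord_def realization_eq_point)

lemma coord_point [simp]: "u \<in> weights F \<Longrightarrow> coord F (point F u) = u"
  unfolding coord_def using inj_on_point by (rule inv_into_f_f)

lemma point_in_realization: "u \<in> weights F \<Longrightarrow> point F u \<in> realization F"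
  by (simp add: realization_eq_point)

lemma closed_realization:
  assumes "G \<subseteq> F"
  shows "closed (realization G)"
  unfolding realization_def using assms finite_scheme finite_member
  by (intro closed_UN) (auto simp: compact_imp_closed finite_imp_compact_convex_hull intro: finite_subset)

text \<open>The realization is a finite union of closed simplices, and on each of them the
  coordinate is zero or affine.\<close>

lemma continuous_on_coord: "continuous_on (realization F) (\<lambda>x. coord F x v)"
  unfolding realization_def
proof (rule continuous_on_closed_Union[OF finite_scheme])
  fix A assume A: "A \<in> F"
  show "closed (convex hull A)"
    using A finite_member by (simp add: compact_imp_closed finite_imp_compact_convex_hull)
  have x: "\<exists>u\<in>weights F. x = point F u \<and> coord F x = u \<and> {v. u v \<noteq> 0} \<subseteq> A"
    if "x \<in> convex hull A" for x
    using that unfolding hull_eq_point[OF A] by auto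
  show "continuous_on (convex hull A) (\<lambda>x. coord F x v)"
  proof (cases "v \<in> A")
    case False
    then have "coord F x v = 0" if "x \<in> convex hull A" for x
      using x[OF that] by auto
    then have "continuous_on (convex hull A) (\<lambda>x. coord F x v) = continuous_on (convex hull A) (\<lambda>x. 0::real)"
      by (intro continuous_on_cong) auto
    then show ?thesis by simp
  next
    case True
    obtain g :: "'a \<Rightarrow> real" and c
      where g: "linear g" "\<forall>w\<in>A. g w + c = (if w = v then 1 else 0)"
      using affine_coordinate[OF affine_independent[OF A] True] by blast
    have "coord F x v = g x + c" if "x \<in> convex hull A" for x
    proof -
      obtain u where u: "u \<in> weights F" "x = point F u" "coord F x = u" "{v. u v \<noteq> 0} \<subseteq> A"
        using x[OF \<open>x \<in> convex hull A\<close>] by blast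
      have "g x + c = (\<Sum>w\<in>\<Union>F. u w * g w) + (\<Sum>w\<in>\<Union>F. u w) * c"
        using u(1) by (simp add: u(2) point_def linear_sum[OF g(1)] linear_cmul[OF g(1)] weights_def)
      also have "\<dots> = (\<Sum>w\<in>\<Union>F. u w * (g w + c))"
        by (simp add: distrib_left sum.distrib sum_distrib_right)
      also have "\<dots> = (\<Sum>w\<in>\<Union>F. if w = v then u v else 0)"
      proof (rule sum.cong[OF refl])
        fix w
        show "u w * (g w + c) = (if w = v then u v else 0)"
          using g(2) u(4) by (cases "w \<in> A") auto
      qed
      also have "\<dots> = u v"
        using True A finite_vertices by auto
      finally show ?thesis
        by (simp add: u(3))
    qed
    then have "continuous_on (convex hull A) (\<lambda>x. coord F x v) = continuous_on (convex hull A) (\<lambda>x. g x + c)"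
      by (intro continuous_on_cong) auto
    moreover have "continuous_on (convex hull A) (\<lambda>x. g x + c)"
      using g(1) by (intro continuous_intros linear_continuous_on) (simp add: linear_conv_bounded_linear)
    ultimately show ?thesis
      by blast
  qed
qed

lemma vertex_scheme_full: "vertex_scheme (full F C)"
  by (rule subscheme) (use subset_closed in \<open>auto simp: full_def\<close>)

text \<open>\<open>meet F C\<close> need not be closed under subsets, so
  \<open>vertex_scheme_sd\<close> does not apply to it; but subchains of chains in it stay in
  it.\<close>

lemma vertex_scheme_sd_meet: "vertex_scheme (sd (meet F C))"
proof (rule vertex_scheme.subscheme[OF vertex_scheme_sd])
  show "sd (meet F C) \<subseteq> sd F"
    by (rule sd_mono) (auto simp: meet_def)
  show "B \<in> sd (meet F C)" if A: "A \<in> sd (meet F C)" and B: "B \<subseteq> A" "B \<noteq> {}" for A B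
  proof -
    obtain D where D: "A = barycenter ` D" "subset.chain (meet F C) D"
      using A by (auto simp: sd_def)
    then obtain E where E: "E \<subseteq> D" "B = barycenter ` E"
      using B(1) subset_image_iff by metis
    then have "subset.chain (meet F C) E" "E \<noteq> {}"
      using D B unfolding subset_chain_def by blast+
    then show ?thesis
      using E by (auto simp: sd_def)
  qed
qed

lemma realization_full: "realization (full F C) = point F ` {u \<in> weights F. {v. u v \<noteq> 0} \<subseteq> C}"
proof (intro equalityI subsetI)
  fix x assume "x \<in> realization (full F C)"
  then obtain A where "A \<in> F" "A \<subseteq> C" "x \<in> convex hull A"
    by (auto simp: realization_def full_def)
  then show "x \<in> point F ` {u \<in> weights F. {v. u v \<noteq> 0} \<subseteq> C}"
    using hull_eq_point by auto
next
  fix x assume "x \<in> point F ` {u \<in> weights F. {v. u v \<noteq> 0} \<subseteq> C}"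
  then obtain u where u: "u \<in> weights F" "{v. u v \<noteq> 0} \<subseteq> C" "x = point F u"
    by auto
  then have "{v. u v \<noteq> 0} \<in> full F C"
    by (auto simp: full_def weights_def)
  then show "x \<in> realization (full F C)"
    using point_in_hull[OF u(1)] u(3) unfolding realization_def by blast
qed

lemma weights_pos_ex:
  assumes "u \<in> weights F"
  obtains v where "v \<in> \<Union>F" "0 < u v" "\<And>w. u w \<le> u v"
proof -
  have "{v. u v \<noteq> 0} \<in> F" and nonneg: "\<And>v. 0 \<le> u v"
    using assms by (auto simp: weights_def)
  then have A: "{v. u v \<noteq> 0} \<noteq> {}" "finite {v. u v \<noteq> 0}" "{v. u v \<noteq> 0} \<subseteq> \<Union>F"
    using nonempty[of "{v. u v \<noteq> 0}"] finite_member by blast+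
  then have M: "Max (u ` {v. u v \<noteq> 0}) \<in> u ` {v. u v \<noteq> 0}"
    by (intro Max_in) auto
  then obtain v where v: "u v \<noteq> 0" "u v = Max (u ` {v. u v \<noteq> 0})"
    by auto
  have "u w \<le> u v" for w
    using A v nonneg[of v] by (cases "u w = 0") auto
  moreover have "v \<in> \<Union>F"
    using A(3) v(1) by blast
  ultimately show thesis
    using that[of v] v(1) nonneg[of v] by (simp add: less_le)
qed

text \<open>The least nonempty superlevel set is the set of vertices with maximal coordinate. All
  nonempty superlevel sets meet \<open>C\<close> exactly if this one does.\<close>

lemma realization_sd_meet:
  "realization (sd (meet F C)) = point F ` {u \<in> weights F. \<exists>v\<in>C. \<forall>w. u w \<le> u v}"
proof (intro equalityI subsetI)
  fix x assume "x \<in> realization (sd (meet F C))"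
  then obtain D where D: "subset.chain (meet F C) D" "x \<in> convex hull (barycenter ` D)"
    by (auto simp: realization_def sd_def)
  then have chain: "subset.chain F D"
    by (auto simp: subset_chain_def meet_def)
  obtain t where t: "\<forall>S\<in>D. 0 \<le> t S" "sum t D = 1" "x = point F (chain_weights D t)"
    using hull_barycenters[OF chain] D(2) by auto
  define u where "u = chain_weights D t"
  have u: "u \<in> weights F" "x = point F u"
    using t chain_weights_in_weights[OF chain] by (auto simp: u_def)
  have levels: "{v. s < u v} \<in> insert {} D" if "0 \<le> s" for s
    using that D(2) u point_in_hull_barycenters_iff[OF chain u(1)] by blast
  have "\<exists>v\<in>C. \<forall>w. u w \<le> u v"
  proof (rule ccontr)
    assume contr: "\<not> ?thesis"
    obtain v0 where v0: "0 < u v0" "\<And>w. u w \<le> u v0"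
      using weights_pos_ex[OF u(1)] by blast
    \<comment> \<open>\<open>s\<close> is the largest coordinate on \<open>C\<close>; the inserted 0
      keeps the maximum defined and nonnegative if \<open>C\<close> contains no vertex. The
      superlevel set at \<open>s\<close> would be a member of \<open>D\<close> missing
      \<open>C\<close>.\<close>
    let ?M = "insert 0 (u ` (C \<inter> \<Union>F))"
    define s where "s = Max ?M"
    have M: "finite ?M" "?M \<noteq> {}"
      using finite_vertices by auto
    have "s \<in> ?M"
      unfolding s_def using M by (rule Max_in)
    then have "s < u v0"
      using contr v0 by (smt (verit, best) IntD1 imageE insertE)
    moreover have "0 \<le> s"
      unfolding s_def using M(1) by simp
    ultimately have "{v. s < u v} \<in> D"
      using levels[of s] by blast
    then have "{v. s < u v} \<in> F" "{v. s < u v} \<inter> C \<noteq> {}"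
      using D(1) by (auto simp: subset_chain_def meet_def)
    then obtain v where v: "v \<in> C" "s < u v" "v \<in> \<Union>F"
      by blast
    then have "u v \<le> s"
      unfolding s_def using M(1) by (intro Max_ge) auto
    then show False
      using v by simp
  qed
  then show "x \<in> point F ` {u \<in> weights F. \<exists>v\<in>C. \<forall>w. u w \<le> u v}"
    using u by blast
next
  fix x assume "x \<in> point F ` {u \<in> weights F. \<exists>v\<in>C. \<forall>w. u w \<le> u v}"
  then obtain u v where u: "u \<in> weights F" "x = point F u" and v: "v \<in> C" "\<forall>w. u w \<le> u v"
    by auto
  have "S \<inter> C \<noteq> {}" if S: "S \<in> superlevels u" for S
  proof -
    obtain s w where "S = {v. s < u v}" "s < u w"
      using S by (auto simp: superlevels_def)
    then have "v \<in> S"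
      using v(2) by (auto intro: less_le_trans)
    then show ?thesis
      using v(1) by blast
  qed
  then have "subset.chain (meet F C) (superlevels u)"
    using superlevels(1)[OF u(1)] by (auto simp: subset_chain_def meet_def)
  then have "barycenter ` superlevels u \<in> sd (meet F C)"
    using superlevels(2)[OF u(1)] by (auto simp: sd_def)
  then show "x \<in> realization (sd (meet F C))"
    using superlevels(3)[OF u(1)] u(2) unfolding realization_def by blast
qed

lemma point_linear: "point F (\<lambda>v. a * u v + b * w v) = a *\<^sub>R point F u + b *\<^sub>R point F w"
  by (simp add: point_def scaleR_left_distrib sum.distrib scaleR_sum_right)

lemma weights_convex:
  assumes u: "u \<in> weights F" "w \<in> weights F" "{v. w v \<noteq> 0} \<subseteq> {v. u v \<noteq> 0}" and t: "0 \<le> t" "t \<le> 1"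
  shows "(\<lambda>v. (1 - t) * u v + t * w v) \<in> weights F"
proof -
  let ?z = "\<lambda>v. (1 - t) * u v + t * w v"
  have sum: "sum ?z (\<Union>F) = 1"
    using u by (simp add: sum.distrib weights_def flip: sum_distrib_left)
  have "{v. ?z v \<noteq> 0} \<noteq> {}"
  proof
    assume "{v. ?z v \<noteq> 0} = {}"
    then have "sum ?z (\<Union>F) = 0"
      by (intro sum.neutral) blast
    then show False
      using sum by simp
  qed
  moreover have "{v. ?z v \<noteq> 0} \<subseteq> {v. u v \<noteq> 0}"
    using u(3) by auto
  moreover have "{v. u v \<noteq> 0} \<in> F" "\<And>v. 0 \<le> ?z v"
    using u t by (auto simp: weights_def)
  ultimately show ?thesis
    using subset_closed sum unfolding weights_def by blast
qed

text \<open>The retraction drops the coordinates outside \<open>C\<close> and rescales by their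
  remaining sum \<open>\<sigma>\<close>, which is positive because a maximal coordinate sits in
  \<open>C\<close>. The homotopy runs along straight segments.\<close>

lemma deformation_retracts_sd_meet:
  "deformation_retracts_onto (realization (sd (meet F C))) (realization (full F C))"
proof -
  let ?S = "realization (sd (meet F C))" and ?T = "realization (full F C)" and ?W = "C \<inter> \<Union>F"
  define \<sigma> where "\<sigma> u = sum u ?W" for u :: "'a \<Rightarrow> real"
  define \<rho> where "\<rho> u v = (if v \<in> C then u v / \<sigma> u else 0)" for u v
  define r where "r x = (\<Sum>v\<in>?W. (coord F x v / \<sigma> (coord F x)) *\<^sub>R v)" for x
  have S: "?S = point F ` {u \<in> weights F. \<exists>v\<in>C. \<forall>w. u w \<le> u v}"
    by (rule realization_sd_meet)
  have T: "?T = point F ` {u \<in> weights F. {v. u v \<noteq> 0} \<subseteq> C}"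
    by (rule realization_full)
  have finW: "finite ?W"
    using finite_vertices by blast
  have \<sigma>_pos: "0 < \<sigma> u" if u: "u \<in> weights F" "\<exists>v\<in>C. \<forall>w. u w \<le> u v" for u
  proof -
    obtain v where v: "v \<in> C" "\<forall>w. u w \<le> u v"
      using u by blast
    obtain v0 where "0 < u v0"
      using weights_pos_ex[OF u(1)] by blast
    then have "0 < u v"
      using v(2) by (meson less_le_trans)
    moreover from this have "v \<in> ?W"
      using v(1) weights_zero[OF u(1)] by fastforce
    moreover have "u v \<le> \<sigma> u"
      unfolding \<sigma>_def using finW \<open>v \<in> ?W\<close> u(1) by (intro member_le_sum) (auto simp: weights_def)
    ultimately show ?thesis by simp
  qed
  have \<rho>: "\<rho> u \<in> weights F" "{v. \<rho> u v \<noteq> 0} \<subseteq> {v. u v \<noteq> 0} \<inter> C"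
    if u: "u \<in> weights F" "\<exists>v\<in>C. \<forall>w. u w \<le> u v" for u
  proof -
    show sub: "{v. \<rho> u v \<noteq> 0} \<subseteq> {v. u v \<noteq> 0} \<inter> C"
      by (auto simp: \<rho>_def)
    have "sum (\<rho> u) (\<Union>F) = sum (\<rho> u) ?W"
      using finite_vertices by (intro sum.mono_neutral_right) (auto simp: \<rho>_def)
    also have "\<dots> = (\<Sum>v\<in>?W. u v / \<sigma> u)"
      by (intro sum.cong) (auto simp: \<rho>_def)
    also have "\<dots> = 1"
      using \<sigma>_pos[OF u] by (simp add: \<sigma>_def flip: sum_divide_distrib)
    finally have sum: "sum (\<rho> u) (\<Union>F) = 1" .
    have "{v. \<rho> u v \<noteq> 0} \<noteq> {}"
    proof
      assume "{v. \<rho> u v \<noteq> 0} = {}"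
      then have "sum (\<rho> u) (\<Union>F) = 0"
        by (intro sum.neutral) blast
      then show False
        using sum by simp
    qed
    moreover have "{v. u v \<noteq> 0} \<in> F"
      using u(1) by (simp add: weights_def)
    ultimately have "{v. \<rho> u v \<noteq> 0} \<in> F"
      using sub by (meson Int_subset_iff subset_closed)
    then show "\<rho> u \<in> weights F"
      using sum \<sigma>_pos[OF u] u(1) by (auto simp: weights_def \<rho>_def)
  qed
  have r: "r (point F u) = point F (\<rho> u)" if "u \<in> weights F" for u
  proof -
    have "r (point F u) = (\<Sum>v\<in>?W. \<rho> u v *\<^sub>R v)"
      using that by (auto simp: r_def \<rho>_def intro!: sum.cong)
    also have "\<dots> = point F (\<rho> u)"
      unfolding point_def using finite_vertices by (intro sum.mono_neutral_left) (auto simp: \<rho>_def)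
    finally show ?thesis .
  qed
  have T_S: "?T \<subseteq> ?S"
  proof
    fix x assume "x \<in> ?T"
    then obtain u where u: "u \<in> weights F" "{v. u v \<noteq> 0} \<subseteq> C" "x = point F u"
      using T by auto
    moreover obtain v where "0 < u v" "\<And>w. u w \<le> u v"
      using weights_pos_ex[OF u(1)] by blast
    moreover from this have "v \<in> C"
      using u(2) by auto
    ultimately show "x \<in> ?S"
      unfolding S by blast
  qed
  have S_F: "?S \<subseteq> realization F"
    unfolding S realization_eq_point by blast
  have cont: "continuous_on ?S r"
  proof -
    have "\<sigma> (coord F x) \<noteq> 0" if "x \<in> ?S" for x
      using that \<sigma>_pos unfolding S by fastforce
    moreover have "continuous_on ?S (\<lambda>x. coord F x v)" for v
      using continuous_on_coord S_F continuous_on_subset by blast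
    ultimately show ?thesis
      unfolding r_def \<sigma>_def by (intro continuous_intros) auto
  qed
  have fix_T: "r x = x" if "x \<in> ?T" for x
  proof -
    obtain u where u: "u \<in> weights F" "{v. u v \<noteq> 0} \<subseteq> C" "x = point F u"
      using \<open>x \<in> ?T\<close> T by auto
    have "sum u (\<Union>F) = \<sigma> u"
      unfolding \<sigma>_def using finite_vertices u(2) by (intro sum.mono_neutral_right) auto
    then have "\<rho> u = u"
      using u(1,2) by (auto simp: \<rho>_def weights_def fun_eq_iff)
    then show ?thesis
      using r[OF u(1)] u(3) by simp
  qed
  have "r x \<in> ?T" if x: "x \<in> ?S" for x
  proof -
    obtain u where u: "u \<in> weights F" "\<exists>v\<in>C. \<forall>w. u w \<le> u v" "x = point F u"
      using x unfolding S by blast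
    then have "\<rho> u \<in> {u \<in> weights F. {v. u v \<noteq> 0} \<subseteq> C}"
      using \<rho>[OF u(1,2)] by blast
    then show ?thesis
      unfolding T u(3) r[OF u(1)] by (rule imageI)
  qed
  then have "retraction ?S ?T r"
    using T_S cont fix_T by (auto simp: retraction_def)
  moreover have "homotopic_with_canon (\<lambda>h. \<forall>x\<in>?T. h x = x) ?S ?S id r"
    unfolding homotopic_with_def
  proof (intro exI[of _ "\<lambda>(t, x). (1 - t) *\<^sub>R x + t *\<^sub>R r x"] conjI ballI allI)
    have "continuous_on ({0..1} \<times> ?S) (\<lambda>z::real \<times> 'a. (1 - fst z) *\<^sub>R snd z + fst z *\<^sub>R r (snd z))"
      by (intro continuous_intros continuous_on_compose2[OF cont]) auto
    moreover have "(1 - t) *\<^sub>R x + t *\<^sub>R r x \<in> ?S" if t: "t \<in> {0..1}" and x: "x \<in> ?S" for t x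
    proof -
      obtain u v where u: "u \<in> weights F" "x = point F u" and v: "v \<in> C" "\<forall>w. u w \<le> u v"
        using x S by auto
      note ex = bexI[of "\<lambda>v. \<forall>w. u w \<le> u v", OF v(2,1)]
      let ?z = "\<lambda>v. (1 - t) * u v + t * \<rho> u v"
      have "?z \<in> weights F"
        using t \<rho>[OF u(1) ex] by (intro weights_convex u(1)) auto
      \<comment> \<open>Rescaling keeps the order of the coordinates in \<open>C\<close> and kills
        the others, so \<open>v\<close> remains a maximum along the whole segment.\<close>
      moreover have "?z w \<le> ?z v" for w
      proof -
        have "\<rho> u w \<le> \<rho> u v"
          using v \<sigma>_pos[OF u(1) ex] u(1) by (auto simp: \<rho>_def weights_def divide_right_mono)
        then show ?thesis
          using t v(2) by (intro add_mono mult_left_mono) auto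
      qed
      moreover have "(1 - t) *\<^sub>R x + t *\<^sub>R r x = point F ?z"
        using u r by (simp add: point_linear)
      ultimately show ?thesis
        unfolding S using v(1) by blast
    qed
    ultimately show "continuous_map (prod_topology (top_of_set {0..1}) (top_of_set ?S)) (top_of_set ?S)
        (\<lambda>(t, x). (1 - t) *\<^sub>R x + t *\<^sub>R r x)"
      by (auto simp: case_prod_unfold simp flip: subtopology_Times euclidean_product_topology)
  qed (auto simp: fix_T algebra_simps)
  ultimately show ?thesis
    unfolding deformation_retracts_onto_def by blast
qed

end

section \<open>The partition of a colouring\<close>

context vertex_scheme
begin

lemma aff_dim_hull: "A \<in> F \<Longrightarrow> aff_dim (convex hull A) = int (card A) - 1"
  using aff_dim_affine_independent[OF affine_independent] by (simp add: aff_dim_convex_hull)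

text \<open>Simplices of the subdivision lie in simplices of \<open>F\<close>, which bounds the
  dimension; a full flag of faces of \<open>A\<close> attains the bound.\<close>

lemma complex_dim_sd:
  assumes "\<And>A. A \<in> F \<Longrightarrow> card A \<le> Suc m" and A: "A \<in> F" "card A = Suc m"
  shows "complex_dim (complex_of (sd F)) = int m"
proof -
  interpret sd: vertex_scheme "sd F"
    by (rule vertex_scheme_sd)
  have le: "aff_dim (convex hull B) \<le> int m" if B: "B \<in> sd F" for B
  proof -
    obtain S where "S \<in> F" "convex hull B \<subseteq> convex hull S"
      using sd_refines[OF B] by blast
    then show ?thesis
      using assms(1) aff_dim_subset[of "convex hull B" "convex hull S"] aff_dim_hull by force
  qed
  obtain b where "b \<in> A"
    using A by fastforce
  then obtain D where D: "subset.chain {T. b \<in> T \<and> T \<subseteq> A} D" "A \<in> D" "card D = card A"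
    using flag_exists[OF finite_member[OF A(1)] \<open>b \<in> A\<close>] by blast
  have "T \<in> F" if "T \<in> D" for T
    using that D(1) by (intro subset_closed[OF A(1)]) (auto simp: subset_chain_def)
  then have chain: "subset.chain F D"
    using D(1) by (simp add: subset_chain_def subsetI)
  then have "barycenter ` D \<in> sd F"
    using D(2) unfolding sd_def by blast
  moreover have "card (barycenter ` D) = Suc m"
    using card_image[OF inj_on_barycenter_chain[OF chain]] D(3) A(2) by simp
  ultimately have "int m \<in> aff_dim ` complex_of (sd F)"
    using sd.aff_dim_hull by (intro image_eqI[of _ _ "convex hull (barycenter ` D)"]) (auto simp: complex_of_def)
  moreover have "finite (complex_of (sd F))"
    using sd.finite_scheme by (simp add: complex_of_def)
  ultimately show ?thesis
    unfolding complex_dim_def using le by (intro Max_eqI) (auto simp: complex_of_def)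
qed

text \<open>Moving towards a vertex of maximal coordinate makes it the only maximum, by an
  arbitrarily small move inside the simplex. This supplies the density needed for the
  partition.\<close>

lemma push_to_vertex:
  assumes u: "u \<in> weights F" and v: "u v \<noteq> 0" "\<And>w. u w \<le> u v" and "0 < \<epsilon>" "\<epsilon> \<le> 1"
  obtains z where "z \<in> weights F" "\<And>w. w \<noteq> v \<Longrightarrow> z w < z v"
    "point F z = (1 - \<epsilon>) *\<^sub>R point F u + \<epsilon> *\<^sub>R v"
proof -
  let ?d = "\<lambda>w. if w = v then 1 else 0 :: real"
  let ?z = "\<lambda>w. (1 - \<epsilon>) * u w + \<epsilon> * ?d w"
  have supp: "{v. u v \<noteq> 0} \<in> F"
    using u by (auto simp: weights_def)
  then have "{v} \<in> F"
    using v(1) subset_closed[OF supp, of "{v}"] by simp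
  then have "?d \<in> weights F"
    using finite_vertices by (auto simp: weights_def)
  then have "?z \<in> weights F"
    using u v assms by (intro weights_convex) auto
  moreover have "point F ?d = v"
    using \<open>{v} \<in> F\<close> finite_vertices unfolding point_def
    by (subst sum.mono_neutral_right[of _ "{v}"]) auto
  then have "point F ?z = (1 - \<epsilon>) *\<^sub>R point F u + \<epsilon> *\<^sub>R v"
    by (simp only: point_linear)
  moreover have "?z w < ?z v" if "w \<noteq> v" for w
  proof -
    have "(1 - \<epsilon>) * u w \<le> (1 - \<epsilon>) * u v"
      using v(2) assms by (intro mult_left_mono) auto
    then show ?thesis
      using that assms by simp
  qed
  ultimately show thesis
    using that[of ?z] by blast
qed

lemma openin_coord_less:
  "openin (top_of_set (realization F)) {x \<in> realization F. coord F x w < coord F x v}"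
proof -
  have "continuous_on (realization F) (\<lambda>x. coord F x v - coord F x w)"
    by (intro continuous_intros continuous_on_coord)
  then have "openin (top_of_set (realization F)) (realization F \<inter> (\<lambda>x. coord F x v - coord F x w) -` {0<..})"
    by (rule continuous_openin_preimage_gen) simp
  also have "realization F \<inter> (\<lambda>x. coord F x v - coord F x w) -` {0<..}
    = {x \<in> realization F. coord F x w < coord F x v}"
    by auto
  finally show ?thesis .
qed

text \<open>Let \<open>G i\<close> be the set where colour \<open>i\<close> beats every other colour
  strictly. It is open, dense in the closed set \<open>P i\<close> and disjoint from every other
  \<open>P j\<close>; both conditions on interiors follow from this.\<close>

lemma is_partition_sd_meet:
  assumes c: "c ` \<Union>F \<subseteq> I"
  shows "is_partition (top_of_set (realization F)) I (\<lambda>i. realization (sd (meet F (c -` {i}))))"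
proof -
  let ?X = "top_of_set (realization F)"
  define P where "P i = realization (sd (meet F (c -` {i})))" for i
  define G where "G i = {x \<in> realization F. \<exists>v\<in>\<Union>F. c v = i \<and>
    (\<forall>w\<in>\<Union>F. c w \<noteq> i \<longrightarrow> coord F x w < coord F x v)}" for i
  have P: "P i = {x \<in> realization F. \<exists>v. c v = i \<and> (\<forall>w. coord F x w \<le> coord F x v)}" for i
    unfolding P_def realization_sd_meet
  proof (intro equalityI subsetI)
    fix x assume "x \<in> {x \<in> realization F. \<exists>v. c v = i \<and> (\<forall>w. coord F x w \<le> coord F x v)}"
    then show "x \<in> point F ` {u \<in> weights F. \<exists>v\<in>c -` {i}. \<forall>w. u w \<le> u v}"
      using coord_in_weights by (intro image_eqI[of _ _ "coord F x"]) auto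
  qed (auto simp: point_in_realization)
  have max: "\<exists>v\<in>\<Union>F. coord F x v \<noteq> 0 \<and> (\<forall>w. coord F x w \<le> coord F x v)" if x: "x \<in> realization F" for x
  proof -
    obtain v where "v \<in> \<Union>F" "0 < coord F x v" "\<And>w. coord F x w \<le> coord F x v"
      using weights_pos_ex[OF coord_in_weights[OF x]] by blast
    then show ?thesis
      by (intro bexI[of _ v]) auto
  qed
  have G_sub: "G i \<subseteq> P i" for i
  proof
    fix x assume "x \<in> G i"
    then obtain v where v: "x \<in> realization F" "v \<in> \<Union>F"
        "\<forall>w\<in>\<Union>F. c w \<noteq> i \<longrightarrow> coord F x w < coord F x v"
      by (auto simp: G_def)
    obtain v0 where v0: "v0 \<in> \<Union>F" "\<forall>w. coord F x w \<le> coord F x v0"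
      using max[OF v(1)] by blast
    then have "c v0 = i"
      using v by (meson not_le)
    then show "x \<in> P i"
      using v0 v(1) by (auto simp: P)
  qed
  have G_disj: "G i \<inter> P j = {}" if ij: "i \<noteq> j" for i j
  proof (rule ccontr)
    assume "G i \<inter> P j \<noteq> {}"
    then obtain x v v' where x: "x \<in> realization F" "c v' = j" "\<forall>w. coord F x w \<le> coord F x v'"
      and v: "v \<in> \<Union>F" "\<forall>w\<in>\<Union>F. c w \<noteq> i \<longrightarrow> coord F x w < coord F x v"
      by (auto simp: G_def P)
    \<comment> \<open>The colouring is defined on all points of the space, so \<open>v'\<close> has
      to be recognised as a vertex: a maximal coordinate is positive.\<close>
    have "v' \<in> \<Union>F"
    proof (rule ccontr)
      assume "v' \<notin> \<Union>F"
      then have "coord F x v' = 0"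
        by (rule weights_zero[OF coord_in_weights[OF x(1)]])
      moreover obtain w where "0 < coord F x w"
        using weights_pos_ex[OF coord_in_weights[OF x(1)]] by blast
      ultimately show False
        using x(3) by (metis not_le)
    qed
    then show False
      using v x ij by (metis not_le)
  qed
  have G_open: "openin ?X (G i)" for i
  proof -
    have *: "openin ?X {x \<in> realization F. \<forall>w\<in>A. coord F x w < coord F x v}" if "finite A" for A v
      using that
    proof (induction A)
      case (insert a A)
      have "{x \<in> realization F. \<forall>w\<in>insert a A. coord F x w < coord F x v}
        = {x \<in> realization F. coord F x a < coord F x v} \<inter> {x \<in> realization F. \<forall>w\<in>A. coord F x w < coord F x v}"
        by auto
      then show ?case
        using openin_coord_less insert.IH by auto
    qed simp
    have "G i = (\<Union>v\<in>{v \<in> \<Union>F. c v = i}.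
      {x \<in> realization F. \<forall>w\<in>{w \<in> \<Union>F. c w \<noteq> i}. coord F x w < coord F x v})"
      by (auto simp: G_def)
    also have "openin ?X \<dots>"
      using finite_vertices by (intro openin_Union) (blast intro!: * finite_subset[OF _ finite_vertices])
    finally show ?thesis .
  qed
  have dense: "P i \<subseteq> ?X closure_of G i" for i
  proof
    fix x assume "x \<in> P i"
    then obtain v where x: "x \<in> realization F" and v: "c v = i" "\<And>w. coord F x w \<le> coord F x v"
      by (auto simp: P)
    have u: "coord F x \<in> weights F"
      using x by (rule coord_in_weights)
    obtain v0 where "0 < coord F x v0"
      using weights_pos_ex[OF u] by blast
    then have v_pos: "coord F x v \<noteq> 0"
      using v(2)[of v0] by linarith
    have vF: "v \<in> \<Union>F"
      using weights_zero[OF u] v_pos by blast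
    have near: "\<exists>y\<in>G i. dist y x < e" if e: "0 < e" for e
    proof -
      \<comment> \<open>Chosen so that the displacement \<open>\<epsilon> * norm (v - x)\<close>
        stays below \<open>e\<close>; adding 1 avoids a zero denominator.\<close>
      define \<epsilon> where "\<epsilon> = min 1 (e / (2 * (norm (v - x) + 1)))"
      have pos: "0 < 2 * (norm (v - x) + 1)"
        by (simp add: add_nonneg_pos)
      then have \<epsilon>: "0 < \<epsilon>" "\<epsilon> \<le> 1" "\<epsilon> \<le> e / (2 * (norm (v - x) + 1))"
        using e by (auto simp: \<epsilon>_def)
      obtain z where z: "z \<in> weights F" "\<And>w. w \<noteq> v \<Longrightarrow> z w < z v"
        "point F z = (1 - \<epsilon>) *\<^sub>R point F (coord F x) + \<epsilon> *\<^sub>R v"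
        using push_to_vertex[OF u v_pos v(2) \<epsilon>(1,2)] by blast
      have "point F z - x = \<epsilon> *\<^sub>R (v - x)"
        using x z(3) by (simp add: algebra_simps)
      then have "dist (point F z) x = \<epsilon> * norm (v - x)"
        using \<epsilon> by (simp add: dist_norm)
      also have "\<dots> \<le> e / (2 * (norm (v - x) + 1)) * norm (v - x)"
        using \<epsilon> by (intro mult_right_mono) auto
      also have "\<dots> < e"
        using e pos by (simp add: field_simps add_strict_increasing)
      finally have "dist (point F z) x < e" .
      moreover have "\<forall>w\<in>\<Union>F. c w \<noteq> i \<longrightarrow> z w < z v"
        using z(2) v(1) by metis
      then have "point F z \<in> G i"
        unfolding G_def using z(1) v(1) vF point_in_realization coord_point by (intro CollectI) metis
      ultimately show ?thesis
        by blast
    qed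
    then have "x \<in> closure (G i)"
      by (simp add: closure_approachable)
    moreover have "G i \<subseteq> realization F"
      by (auto simp: G_def)
    ultimately show "x \<in> ?X closure_of G i"
      using x by (simp add: closure_of_subtopology Int_absorb1)
  qed
  have P_closed: "closedin ?X (P i)" for i
  proof -
    have "closed (P i)"
      unfolding P_def by (rule vertex_scheme.closed_realization[OF vertex_scheme_sd_meet order_refl])
    then show ?thesis
      using P by (intro closed_subset) auto
  qed
  have cover: "(\<Union>i\<in>I. P i) = realization F"
  proof (intro equalityI subsetI)
    fix x assume x: "x \<in> realization F"
    then obtain v where v: "v \<in> \<Union>F" "\<forall>w. coord F x w \<le> coord F x v"
      using max by blast
    then have "x \<in> P (c v)"
      using x by (auto simp: P)
    then show "x \<in> (\<Union>i\<in>I. P i)"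
      using c v(1) by blast
  qed (auto simp: P)
  have disj: "?X interior_of P i \<inter> ?X interior_of P j = {}" if ij: "i \<noteq> j" for i j
  proof (rule ccontr)
    assume "?X interior_of P i \<inter> ?X interior_of P j \<noteq> {}"
    then obtain x where x: "x \<in> ?X interior_of P i" "x \<in> ?X interior_of P j"
      by blast
    then have "x \<in> realization F"
      using interior_of_subset_topspace by fastforce
    then obtain l where l: "x \<in> P l"
      using cover by blast
    \<comment> \<open>Since \<open>i\<close> and \<open>j\<close> differ, one of them differs from
      \<open>l\<close>. An open set inside \<open>P m\<close> around a point of \<open>P l\<close>
      would meet the dense part \<open>G l\<close>, which is disjoint from
      \<open>P m\<close>.\<close>
    have False if m: "m \<noteq> l" "x \<in> ?X interior_of P m" for m
    proof -
      have "x \<in> ?X closure_of G l"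
        using dense l by blast
      then obtain y where "y \<in> G l" "y \<in> ?X interior_of P m"
        unfolding in_closure_of using m(2) openin_interior_of[of ?X "P m"] by metis
      then show False
        using G_disj[of l m] m(1) interior_of_subset[of ?X "P m"] by blast
    qed
    then show False
      using x ij by metis
  qed
  have "?X closure_of (?X interior_of P i) = P i" for i
  proof
    show "?X closure_of (?X interior_of P i) \<subseteq> P i"
      using P_closed by (simp add: closure_of_minimal interior_of_subset)
    have "G i \<subseteq> ?X interior_of P i"
      using G_sub G_open by (rule interior_of_maximal)
    then show "P i \<subseteq> ?X closure_of (?X interior_of P i)"
      using dense closure_of_mono by blast
  qed
  then show ?thesis
    unfolding is_partition_def using cover disj by (simp flip: P_def)
qed

end

section \<open>Categorical sets\<close>

lemma categorical_set_subset:
  assumes "categorical_set X Y f A" "B \<subseteq> A"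
  shows "categorical_set X Y f B"
proof -
  obtain c where c: "homotopic_with (\<lambda>_. True) (subtopology X A) Y f (\<lambda>_. c)"
    using assms by (auto simp: categorical_set_def null_homotopic_def)
  have "continuous_map (subtopology X B) (subtopology X A) id"
    using assms(2) continuous_map_id_subt continuous_map_in_subtopology[of "subtopology X B" X A id]
    by auto
  then have "homotopic_with (\<lambda>_. True) (subtopology X B) Y (f \<circ> id) ((\<lambda>_. c) \<circ> id)"
    by (rule homotopic_with_compose_continuous_map_right[OF c]) simp
  then show ?thesis
    using assms by (auto simp: categorical_set_def null_homotopic_def o_def)
qed

text \<open>The track of \<open>x\<close> under the null-homotopy is a path from \<open>f x\<close>
  to \<open>c\<close>, so the constant can be moved to any point in the path component of
  \<open>f x\<close>.\<close>

lemma null_homotopic_const: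
  assumes hom: "homotopic_with (\<lambda>_. True) Z Y f (\<lambda>_. c)" and "x \<in> topspace Z" "path_component_of Y (f x) y"
  shows "homotopic_with (\<lambda>_. True) Z Y f (\<lambda>_. y)"
proof -
  have "continuous_map Z Z (\<lambda>_. x)"
    using assms(2) by simp
  then have "homotopic_with (\<lambda>_. True) Z Y (f \<circ> (\<lambda>_. x)) ((\<lambda>_. c) \<circ> (\<lambda>_. x))"
    by (rule homotopic_with_compose_continuous_map_right[OF hom]) simp
  then have "path_component_of Y (f x) c"
    using assms(2) homotopic_constant_maps[of Z Y "f x" c] by (auto simp: o_def)
  then have "path_component_of Y c y"
    using assms(3) path_component_of_sym path_component_of_trans by metis
  then have "homotopic_with (\<lambda>_. True) Z Y (\<lambda>_. c) (\<lambda>_. y)"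
    by (simp add: homotopic_constant_maps)
  then show ?thesis
    using hom homotopic_with_trans by blast
qed

text \<open>All null-homotopies are first moved to the common constant \<open>f x0\<close>, which is
  where the condition on path components enters. Then they are glued over the disjoint closed
  pieces.\<close>

lemma categorical_set_UN:
  assumes I: "finite I" and clo: "\<And>i. i \<in> I \<Longrightarrow> closedin X (A i)"
    and cat: "\<And>i. i \<in> I \<Longrightarrow> categorical_set X Y f (A i)"
    and disj: "\<And>i j. i \<in> I \<Longrightarrow> j \<in> I \<Longrightarrow> i \<noteq> j \<Longrightarrow> A i \<inter> A j = {}"
    and f: "\<forall>x\<in>topspace X. \<forall>x'\<in>topspace X. path_component_of Y (f x) (f x')"
  shows "categorical_set X Y f (\<Union>i\<in>I. A i)"
proof (cases "(\<Union>i\<in>I. A i) = {}")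
  case True
  then show ?thesis
    \<comment> \<open>On the empty set every constant works, whatever its value.\<close>
    unfolding categorical_set_def null_homotopic_def
    by (auto intro!: exI[of _ undefined] homotopic_with_equal)
next
  case False
  let ?A = "\<Union>i\<in>I. A i" and ?I = "top_of_set {0..1::real}"
  have sub: "A i \<subseteq> topspace X" if "i \<in> I" for i
    using clo[OF that] by (rule closedin_subset)
  obtain x0 where x0: "x0 \<in> ?A"
    using False by blast
  then have x0X: "x0 \<in> topspace X"
    using sub by blast
  have "homotopic_with (\<lambda>_. True) (subtopology X (A i)) Y f (\<lambda>_. f x0)" if i: "i \<in> I" for i
  proof (cases "A i = {}")
    case True
    then show ?thesis
      by (auto intro!: homotopic_with_equal)
  next
    case False
    then obtain x where x: "x \<in> A i"
      by blast
    obtain c where "homotopic_with (\<lambda>_. True) (subtopology X (A i)) Y f (\<lambda>_. c)"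
      using cat[OF i] by (auto simp: categorical_set_def null_homotopic_def)
    then show ?thesis
      using null_homotopic_const[of "subtopology X (A i)" Y f c x "f x0"] f x x0X sub[OF i] by auto
  qed
  then have "\<forall>i\<in>I. \<exists>h. continuous_map (prod_topology ?I (subtopology X (A i))) Y h \<and>
      (\<forall>x. h (0, x) = f x) \<and> (\<forall>x. h (1, x) = f x0)"
    unfolding homotopic_with_def by blast
  then obtain h where h: "\<And>i. i \<in> I \<Longrightarrow> continuous_map (prod_topology ?I (subtopology X (A i))) Y (h i)"
    "\<And>i x. i \<in> I \<Longrightarrow> h i (0, x) = f x" "\<And>i x. i \<in> I \<Longrightarrow> h i (1, x) = f x0"
    by metis
  let ?P = "prod_topology ?I (subtopology X ?A)"
  obtain g where g: "continuous_map ?P Y g"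
    "\<And>x i. i \<in> I \<Longrightarrow> x \<in> topspace ?P \<inter> ({0..1} \<times> A i) \<Longrightarrow> g x = h i x"
  proof (rule pasting_lemma_exists_closed[of I ?P "\<lambda>i. {0..1} \<times> A i" Y h])
    show "closedin ?P ({0..1} \<times> A i)" if "i \<in> I" for i
    proof -
      have "closedin (subtopology X ?A) (A i)"
        using clo[OF that] that by (intro closedin_subset_topspace) auto
      then show ?thesis
        by (simp add: closedin_prod_Times_iff)
    qed
    show "continuous_map (subtopology ?P ({0..1} \<times> A i)) Y (h i)" if "i \<in> I" for i
    proof -
      have "subtopology ?P ({0..1} \<times> A i) = prod_topology ?I (subtopology X (A i))"
        using that by (simp add: subtopology_Times subtopology_subtopology Int_absorb1 UN_upper)
      then show ?thesis
        using h(1)[OF that] by simp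
    qed
    show "h i x = h j x" if "i \<in> I" "j \<in> I" "x \<in> topspace ?P \<inter> ({0..1} \<times> A i) \<inter> ({0..1} \<times> A j)" for i j x
      using that disj[of i j] by (cases "i = j") auto
  qed (use I in auto)
  have "homotopic_with (\<lambda>_. True) (subtopology X ?A) Y f (\<lambda>_. f x0)"
  proof (subst homotopic_with, simp, intro exI[of _ g] conjI ballI)
    fix x assume "x \<in> topspace (subtopology X ?A)"
    then obtain i where i: "i \<in> I" "x \<in> A i" "x \<in> topspace X"
      by auto
    then have "g (t, x) = h i (t, x)" if "t \<in> {0..1}" for t
      using that g(2)[OF i(1), of "(t, x)"] by auto
    then show "g (0, x) = f x" "g (1, x) = f x0"
      using h(2,3)[OF i(1)] by auto
  qed (use g(1) in auto)
  then show ?thesis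
    using sub by (auto simp: categorical_set_def null_homotopic_def)
qed

lemma categorical_set_convex:
  fixes C :: "'a::euclidean_space set"
  assumes "continuous_map (top_of_set S) Y f" "C \<subseteq> S" "convex C"
  shows "categorical_set (top_of_set S) Y f C"
proof -
  have "contractible_space (top_of_set C)"
    using assms(3) by (simp add: convex_imp_contractible)
  moreover have "continuous_map (top_of_set C) Y f"
    using assms(1,2) by (metis continuous_map_from_subtopology_mono)
  ultimately obtain c where "homotopic_with (\<lambda>_. True) (top_of_set C) Y f (\<lambda>_. c)"
    using nullhomotopic_from_contractible_space by blast
  then show ?thesis
    using assms(2) by (auto simp: categorical_set_def null_homotopic_def subtopology_subtopology Int_absorb1)
qed

text \<open>On \<open>A\<close>, \<open>f\<close> is homotopic to \<open>f \<circ> r\<close>, and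
  this factors through \<open>B\<close>, where \<open>f\<close> is null-homotopic.\<close>

lemma categorical_set_deformation_retract:
  assumes f: "continuous_map (top_of_set S) Y f" and "A \<subseteq> S"
    and retr: "deformation_retracts_onto A B" and cat: "categorical_set (top_of_set S) Y f B"
  shows "categorical_set (top_of_set S) Y f A"
proof -
  obtain r where r: "retraction A B r" "homotopic_with_canon (\<lambda>h. \<forall>x\<in>B. h x = x) A A id r"
    using retr by (auto simp: deformation_retracts_onto_def)
  have "B \<subseteq> A"
    using r(1) by (simp add: retraction_def)
  have top: "subtopology (top_of_set S) A = top_of_set A" "subtopology (top_of_set S) B = top_of_set B"
    using \<open>A \<subseteq> S\<close> \<open>B \<subseteq> A\<close> by (auto simp: subtopology_subtopology Int_absorb1)
  obtain c where c: "homotopic_with (\<lambda>_. True) (top_of_set B) Y f (\<lambda>_. c)"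
    using cat top by (auto simp: categorical_set_def null_homotopic_def)
  have "continuous_map (top_of_set A) Y f"
    using f \<open>A \<subseteq> S\<close> by (metis continuous_map_from_subtopology_mono)
  then have "homotopic_with (\<lambda>_. True) (top_of_set A) Y (f \<circ> id) (f \<circ> r)"
    by (rule homotopic_with_compose_continuous_map_left[OF r(2)]) simp
  moreover have "continuous_map (top_of_set A) (top_of_set B) r"
    using r(1) by (auto simp: retraction_def)
  then have "homotopic_with (\<lambda>_. True) (top_of_set A) Y (f \<circ> r) ((\<lambda>_. c) \<circ> r)"
    by (rule homotopic_with_compose_continuous_map_right[OF c]) simp
  ultimately have "homotopic_with (\<lambda>_. True) (top_of_set A) Y f (\<lambda>_. c)"
    using homotopic_with_trans by (fastforce simp: o_def)
  then show ?thesis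
    using \<open>A \<subseteq> S\<close> top by (auto simp: categorical_set_def null_homotopic_def)
qed

section \<open>Colours from labels\<close>

text \<open>\<open>card S\<close> is the dimension plus one, so the label is clamped to a window of
  \<open>m + 1\<close> values ending there. For \<open>card S \<le> m\<close> the truncated lower
  end is 0 and imposes nothing.\<close>

definition colour :: "nat \<Rightarrow> ('a set \<Rightarrow> nat) \<Rightarrow> 'a set \<Rightarrow> nat" where
  "colour m J S = max (card S - m) (min (J S) (card S))"

text \<open>Suppose \<open>J S < J T\<close>. The common colour is at most
  \<open>card S < card T\<close>, so it is at least \<open>J T\<close>. As it exceeds
  \<open>J S\<close>, it must be the lower end \<open>card S - m\<close>, which is positive and
  therefore less than \<open>card T - m\<close>, a contradiction.\<close>

lemma colour_eq_imp_label_eq: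
  assumes "finite T" "S \<subset> T" "0 < J T" "J S \<le> J T" "colour m J S = colour m J T"
  shows "J S = J T"
proof -
  have "card S < card T"
    using assms(1,2) by (rule psubset_card_mono)
  then show ?thesis
    using assms(3-5) unfolding colour_def by (auto simp: max_def min_def split: if_splits)
qed

text \<open>Members of a chain have distinct cardinalities, and colour \<open>i\<close> confines
  these to \<open>{i..i + m}\<close>.\<close>

lemma card_chain_of_one_colour:
  assumes "\<And>S. S \<in> D \<Longrightarrow> finite S" "subset.chain F D" "\<And>S. S \<in> D \<Longrightarrow> colour m J S = i"
  shows "card D \<le> Suc m"
proof -
  have "inj_on card D"
  proof (rule inj_onI)
    fix S T assume "S \<in> D" "T \<in> D" "card S = card T"
    then show "S = T"
      using assms(1,2) unfolding subset_chain_def by (metis card_subset_eq)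
  qed
  moreover have "card ` D \<subseteq> {i..i + m}"
    using assms(3) by (fastforce simp: colour_def)
  ultimately have "card D \<le> card {i..i + m}"
    by (metis card_image card_mono finite_atLeastAtMost)
  then show ?thesis
    by simp
qed

lemma closed_Union_subcomplex:
  assumes "simplicial_complex K" "V \<subseteq> K"
  shows "closed (\<Union>V)"
proof (rule closed_Union)
  show "finite V"
    using assms finite_subset by (auto simp: simplicial_complex_def)
  show "\<forall>S\<in>V. closed S"
    using assms by (meson compact_imp_closed in_mono polytope_imp_compact simplex_imp_polytope simplicial_complex_def)
qed

context vertex_scheme
begin

text \<open>Simplices of \<open>F\<close> are the vertices of \<open>sd F\<close>, so a labelling of
  \<open>F\<close> colours these vertices and the neighbourhoods of the full subcomplexes of
  \<open>sd F\<close> give the partition. \<open>flag\<close> makes the dimension of the retracts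
  exactly \<open>m\<close>.\<close>

lemma coloured_partition:
  fixes J :: "'a set \<Rightarrow> nat" and f :: "'a \<Rightarrow> 'b"
  defines "X \<equiv> top_of_set (realization F)"
  assumes f: "continuous_map X Y f"
    and paths: "\<forall>x\<in>realization F. \<forall>x'\<in>realization F. path_component_of Y (f x) (f x')"
    and mono: "\<And>S T. T \<in> F \<Longrightarrow> S \<subseteq> T \<Longrightarrow> S \<noteq> {} \<Longrightarrow> J S \<le> J T"
    and J: "\<And>S. S \<in> F \<Longrightarrow> J S \<in> {1..k}"
    and card: "\<And>S. S \<in> F \<Longrightarrow> card S \<le> m + k"
    and cat: "\<And>j. j \<in> {1..k} \<Longrightarrow> categorical_set X Y f (realization {S \<in> F. J S = j})"
    and flag: "\<And>i. i \<in> {1..k} \<Longrightarrow> \<exists>D. subset.chain {S \<in> F. colour m J S = i} D \<and> card D = Suc m"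
  shows "\<exists>P. (\<forall>i\<in>{1..k}. subcomplex (P i) (complex_of (sd (sd F)))) \<and>
     (\<forall>i\<in>{1..k}. categorical_set X Y f (\<Union>(P i))) \<and>
     is_partition X {1..k} (\<lambda>i. \<Union>(P i)) \<and>
     (\<forall>i\<in>{1..k}. \<exists>Q. subcomplex Q (P i) \<and> complex_dim Q = int m \<and>
        deformation_retracts_onto (\<Union>(P i)) (\<Union>Q))"
proof -
  interpret G: vertex_scheme "sd F"
    by (rule vertex_scheme_sd)
  have F_eq: "realization F = realization (sd (sd F))"
    by (simp add: G.realization_sd realization_sd)
  have X: "X = top_of_set (realization (sd F))"
    by (simp add: X_def realization_sd)
  define c where "c p = colour m J (the_inv_into F barycenter p)" for p
  have c: "c (barycenter S) = colour m J S" if "S \<in> F" for S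
    using that inj_on_barycenter by (simp add: c_def the_inv_into_f_f)
  define C where "C i = c -` {i}" for i
  define P where "P i = sd (meet (sd F) (C i))" for i
  \<comment> \<open>The full subcomplex is subdivided once more so that it becomes a subcomplex of
    \<open>P i\<close>.\<close>
  define Q where "Q i = sd (full (sd F) (C i))" for i
  have full_eq: "full (sd F) (C i) = sd {S \<in> F. colour m J S = i}" for i
  proof -
    have "subset.chain {S \<in> F. colour m J S = i} D \<longleftrightarrow> subset.chain F D \<and> barycenter ` D \<subseteq> C i" for D
      using c by (fastforce simp: subset_chain_def C_def)
    then show ?thesis
      unfolding full_def sd_def by auto
  qed
  have "0 < card S" if "S \<in> F" for S
    using nonempty finite_member that by (simp add: card_gt_0_iff)
  then have "colour m J S \<in> {1..k}" if "S \<in> F" for S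
    using that J[OF that] card[OF that] by (fastforce simp: colour_def)
  then have c_range: "c ` \<Union>(sd F) \<subseteq> {1..k}"
    using c by (force simp: sd_def subset_chain_def)
  have realization_PQ: "\<Union>(complex_of (P i)) = realization (sd (meet (sd F) (C i)))"
    "\<Union>(complex_of (Q i)) = realization (full (sd F) (C i))" for i
    using vertex_scheme.realization_sd[OF G.vertex_scheme_full] by (simp_all add: Union_complex_of P_def Q_def)
  have schemes: "vertex_scheme (P i)" "vertex_scheme (Q i)" for i
    unfolding P_def Q_def using G.vertex_scheme_sd_meet vertex_scheme.vertex_scheme_sd[OF G.vertex_scheme_full] by auto
  have "full (sd F) (C i) \<subseteq> meet (sd F) (C i)" for i
    using G.nonempty by (fastforce simp: full_def meet_def)
  then have QP: "Q i \<subseteq> P i" for i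
    unfolding P_def Q_def by (rule sd_mono)
  have PL: "P i \<subseteq> sd (sd F)" for i
    unfolding P_def by (rule sd_mono) (auto simp: meet_def)
  have retr: "deformation_retracts_onto (\<Union>(complex_of (P i))) (\<Union>(complex_of (Q i)))" for i
    unfolding realization_PQ by (rule G.deformation_retracts_sd_meet)
  have dim: "complex_dim (complex_of (Q i)) = int m" if i: "i \<in> {1..k}" for i
  proof -
    have le: "card B \<le> Suc m" if B: "B \<in> full (sd F) (C i)" for B
    proof -
      obtain D where D: "B = barycenter ` D" "subset.chain {S \<in> F. colour m J S = i} D"
        using B unfolding full_eq by (auto simp: sd_def)
      then have "card D \<le> Suc m"
        using finite_member by (intro card_chain_of_one_colour[OF _ D(2), of m J i]) (auto simp: subset_chain_def)
      moreover have "card B \<le> card D"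
        unfolding D(1) using D(2)
        by (intro card_image_le finite_chain) (auto simp: subset_chain_def)
      ultimately show ?thesis
        by simp
    qed
    obtain D where D: "subset.chain {S \<in> F. colour m J S = i} D" "card D = Suc m"
      using flag[OF i] by blast
    then have "barycenter ` D \<in> full (sd F) (C i)"
      unfolding full_eq by (force simp: sd_def)
    moreover have "subset.chain F D"
      using D(1) by (auto simp: subset_chain_def)
    then have "card (barycenter ` D) = Suc m"
      using card_image[OF inj_on_barycenter_chain] D(2) by simp
    ultimately show ?thesis
      unfolding Q_def using vertex_scheme.complex_dim_sd[OF G.vertex_scheme_full le] by blast
  qed
  have "categorical_set X Y f (realization (full (sd F) (C i)))" if i: "i \<in> {1..k}" for i
  proof -
    \<comment> \<open>The part of label \<open>j\<close>. A chain of one colour has one label, so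
      these parts cover the full subcomplex of colour \<open>i\<close>.\<close>
    define H where "H j = sd {S \<in> F. colour m J S = i \<and> J S = j}" for j
    have H_sub: "H j \<subseteq> sd F" for j
      unfolding H_def by (rule sd_mono) auto
    have "realization (full (sd F) (C i)) = (\<Union>j\<in>{1..k}. realization (H j))"
    proof (intro equalityI subsetI)
      fix x assume "x \<in> realization (full (sd F) (C i))"
      then obtain D where D: "D \<noteq> {}" "subset.chain {S \<in> F. colour m J S = i} D"
        "x \<in> convex hull (barycenter ` D)"
        unfolding full_eq by (auto simp: realization_def sd_def)
      obtain S0 where S0: "S0 \<in> D"
        using D(1) by blast
      have memD: "S \<in> F" "colour m J S = i" if "S \<in> D" for S
        using that D(2) by (auto simp: subset_chain_def)
      have J_eq: "J S = J T" if "S \<in> D" "T \<in> D" "S \<subset> T" for S T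
        using that memD finite_member nonempty J[of T]
        by (intro colour_eq_imp_label_eq[of T S J m] mono) auto
      have "J S = J S0" if S: "S \<in> D" for S
      proof -
        have "S = S0 \<or> S \<subset> S0 \<or> S0 \<subset> S"
          using D(2) S S0 unfolding subset_chain_def by blast
        then show ?thesis
          using J_eq S S0 by metis
      qed
      then have "subset.chain {S \<in> F. colour m J S = i \<and> J S = J S0} D"
        using D(2) by (auto simp: subset_chain_def)
      then have "barycenter ` D \<in> H (J S0)"
        unfolding H_def sd_def using D(1) by blast
      then have "x \<in> realization (H (J S0))"
        using D(3) by (auto simp: realization_def)
      then show "x \<in> (\<Union>j\<in>{1..k}. realization (H j))"
        using J memD(1)[OF S0] by blast
    next
      fix x assume "x \<in> (\<Union>j\<in>{1..k}. realization (H j))"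
      moreover have "H j \<subseteq> full (sd F) (C i)" for j
        unfolding H_def full_eq by (rule sd_mono) auto
      ultimately show "x \<in> realization (full (sd F) (C i))"
        by (auto simp: realization_def)
    qed
    moreover have "categorical_set X Y f (\<Union>j\<in>{1..k}. realization (H j))"
    proof (rule categorical_set_UN)
      show "closedin X (realization (H j))" if "j \<in> {1..k}" for j
        unfolding X using G.closed_realization[OF H_sub] H_sub[of j]
        by (intro closed_subset) (auto simp: realization_def)
      show "categorical_set X Y f (realization (H j))" if j: "j \<in> {1..k}" for j
      proof (rule categorical_set_subset[OF cat[OF j]])
        show "realization (H j) \<subseteq> realization {S \<in> F. J S = j}"
        proof
          fix x assume "x \<in> realization (H j)"
          then obtain D where D: "D \<noteq> {}" "subset.chain {S \<in> F. colour m J S = i \<and> J S = j} D"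
            "x \<in> convex hull (barycenter ` D)"
            by (auto simp: realization_def H_def sd_def)
          then have sub: "D \<subseteq> {S \<in> F. J S = j}" and "subset.chain F D"
            by (auto simp: subset_chain_def)
          then have "finite D"
            using finite_chain by blast
          then have top: "\<Union>D \<in> D"
            using Union_in_chain D(1,2) by blast
          have "x \<in> convex hull \<Union>D"
            using D(3) sub by (intro subsetD[OF hull_barycenters_subset[of D "\<Union>D"]]) auto
          then show "x \<in> realization {S \<in> F. J S = j}"
            using top sub unfolding realization_def by blast
        qed
      qed
      \<comment> \<open>A common point lies in the hull of common vertices; a common vertex is the
        barycenter of just one simplex, which has just one label.\<close>
      show "realization (H j) \<inter> realization (H j') = {}" if j: "j \<noteq> j'" for j j'
      proof (rule ccontr)
        assume "realization (H j) \<inter> realization (H j') \<noteq> {}"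
        then obtain x B B' where x: "B \<in> H j" "B' \<in> H j'" "x \<in> convex hull B" "x \<in> convex hull B'"
          by (auto simp: realization_def)
        then have "B \<inter> B' \<noteq> {}"
          using G.hull_Int[OF subsetD[OF H_sub x(1)] subsetD[OF H_sub x(2)]] by auto
        then obtain S S' where "S \<in> F" "S' \<in> F" "J S = j" "J S' = j'" "barycenter S = barycenter S'"
          using x(1,2) unfolding H_def sd_def subset_chain_def by blast
        then show False
          using inj_on_barycenter j by (metis inj_onD)
      qed
    qed (use paths in \<open>auto simp: X_def\<close>)
    ultimately show ?thesis
      by simp
  qed
  moreover have "realization (sd (meet (sd F) (C i))) \<subseteq> realization F" for i
    using PL[of i] F_eq unfolding P_def realization_def by blast
  ultimately have "categorical_set X Y f (\<Union>(complex_of (P i)))" if "i \<in> {1..k}" for i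
    using that unfolding X_def realization_PQ
    by (intro categorical_set_deformation_retract[OF f[unfolded X_def] _ retr[of i, unfolded realization_PQ]])
  moreover have "is_partition X {1..k} (\<lambda>i. \<Union>(complex_of (P i)))"
    using G.is_partition_sd_meet[OF c_range] unfolding X realization_PQ C_def .
  moreover have "subcomplex (complex_of (P i)) (complex_of (sd (sd F)))"
    "subcomplex (complex_of (Q i)) (complex_of (P i))" for i
    using schemes[of i] complex_of_mono[OF PL] complex_of_mono[OF QP]
    by (simp_all add: subcomplex_def vertex_scheme.simplicial_complex)
  ultimately show ?thesis
    using dim retr by (intro exI[of _ "\<lambda>i. complex_of (P i)"]) blast
qed

end

section \<open>Positions of simplices: covering subcomplexes and interior simplices\<close>

lemma barycenter_affine:
  fixes g :: "'a::real_vector \<Rightarrow> real"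
  assumes "linear g" "finite S" "S \<noteq> {}"
  shows "g (barycenter S) + c = (\<Sum>w\<in>S. g w + c) / real (card S)"
  using assms
  by (simp add: barycenter_def linear_cmul linear_sum sum.distrib field_simps card_gt_0_iff)

text \<open>A relative interior point of \<open>T\<close> lies in some member \<open>R\<close> of
  some \<open>V i\<close>. The face \<open>T \<inter> R\<close> of \<open>T\<close> contains it and
  hence is all of \<open>T\<close>, so \<open>T\<close> is a face of \<open>R\<close>.\<close>

lemma simplex_in_covering_subcomplex:
  assumes K: "simplicial_complex K" and T: "T \<in> K" "T \<noteq> {}"
    and V: "\<And>i. i \<in> I \<Longrightarrow> subcomplex (V i) K" and cover: "T \<subseteq> (\<Union>i\<in>I. \<Union>(V i))"
  shows "\<exists>i\<in>I. T \<in> V i"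
proof -
  have "convex T"
    using K T by (meson convex_simplex simplicial_complex_def)
  then obtain p where p: "p \<in> rel_interior T"
    using T(2) rel_interior_eq_empty by blast
  then have "p \<in> T"
    using rel_interior_subset by blast
  then obtain i R where R: "i \<in> I" "R \<in> V i" "p \<in> R"
    using cover by blast
  then have "R \<in> K" and Vi: "simplicial_complex (V i)"
    using V by (auto simp: subcomplex_def)
  then have faces: "(T \<inter> R) face_of T" "(R \<inter> T) face_of R"
    using K T(1) unfolding simplicial_complex_def by blast+
  then have "T \<subseteq> T \<inter> R"
    using subset_of_face_of[OF faces(1) order_refl] p R(3) \<open>p \<in> T\<close> by blast
  then have "T face_of R"
    using faces(2) by (simp add: Int_absorb1)
  then have "T \<in> V i"
    using Vi R(2) unfolding simplicial_complex_def by blast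
  then show ?thesis
    using R(1) by blast
qed

context vertex_scheme
begin

text \<open>In the second subdivision, take a full flag of faces of \<open>M\<close> that all
  contain the barycenter \<open>b\<close> of \<open>A\<close>. Its barycenters have positive
  coordinates at every vertex of \<open>A\<close>, so \<open>B\<close> avoids all proper faces of
  \<open>A\<close>. A single subdivision would in general leave vertices on the boundary.\<close>

lemma interior_simplex:
  assumes A: "A \<in> F"
  obtains B where "B \<in> sd (sd F)" "card B = card A" "convex hull B \<subseteq> convex hull A"
    "\<And>T. T \<in> F \<Longrightarrow> convex hull B \<inter> convex hull T \<noteq> {} \<Longrightarrow> A \<subseteq> T"
proof -
  interpret G: vertex_scheme "sd F"
    by (rule vertex_scheme_sd)
  obtain a where "a \<in> A"
    using nonempty[OF A] by blast
  then obtain D where D: "subset.chain {T. a \<in> T \<and> T \<subseteq> A} D" "A \<in> D" "card D = card A"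
    using flag_exists[OF finite_member[OF A]] by blast
  have "T \<in> F" if "T \<in> D" for T
    using that D(1) by (intro subset_closed[OF A]) (auto simp: subset_chain_def)
  then have chainD: "subset.chain F D"
    using D(1) by (simp add: subset_chain_def subsetI)
  define b where "b = barycenter A"
  define M where "M = barycenter ` D"
  have M: "M \<in> sd F" "b \<in> M"
    using chainD D(2) by (auto simp: M_def b_def sd_def)
  have cardM: "card M = card A"
    unfolding M_def using card_image[OF inj_on_barycenter_chain[OF chainD]] D(3) by simp
  have M_A: "convex hull M \<subseteq> convex hull A"
    unfolding M_def using D(1) \<open>\<And>T. T \<in> D \<Longrightarrow> T \<in> F\<close>
    by (intro hull_barycenters_subset) (auto simp: subset_chain_def)
  obtain E where E: "subset.chain {T. b \<in> T \<and> T \<subseteq> M} E" "M \<in> E" "card E = card M"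
    using flag_exists[OF G.finite_member[OF M(1)] M(2)] by blast
  have E_sd: "T \<in> sd F" if "T \<in> E" for T
    using that E(1) by (intro G.subset_closed[OF M(1)]) (auto simp: subset_chain_def)
  then have chainE: "subset.chain (sd F) E"
    using E(1) by (simp add: subset_chain_def subsetI)
  define B where "B = barycenter ` E"
  show thesis
  proof (rule that)
    show "B \<in> sd (sd F)"
      using chainE E(2) by (auto simp: B_def sd_def)
    show "card B = card A"
      unfolding B_def using card_image[OF G.inj_on_barycenter_chain[OF chainE]] E(3) cardM by simp
    have B_M: "convex hull B \<subseteq> convex hull M"
      unfolding B_def using E(1) E_sd by (intro G.hull_barycenters_subset) (auto simp: subset_chain_def)
    then show B_A: "convex hull B \<subseteq> convex hull A"
      using M_A by blast
    show "A \<subseteq> T" if T: "T \<in> F" "convex hull B \<inter> convex hull T \<noteq> {}" for T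
    proof (rule ccontr)
      assume "\<not> A \<subseteq> T"
      then obtain v where v: "v \<in> A" "v \<notin> T"
        by blast
      obtain g :: "'a \<Rightarrow> real" and c
        where g: "linear g" "\<forall>w\<in>A. g w + c = (if w = v then 1 else 0)"
        using affine_coordinate[OF affine_independent[OF A] v(1)] by blast
      have half: "convex {x. 0 \<le> g x + c}" "convex {x. 0 < g x + c}" "convex {x. g x + c = 0}"
      proof -
        have "{x. 0 \<le> g x + c} = g -` {- c..}" "{x. 0 < g x + c} = g -` {- c<..}" "{x. g x + c = 0} = g -` {- c}"
          by auto
        then show "convex {x. 0 \<le> g x + c}" "convex {x. 0 < g x + c}" "convex {x. g x + c = 0}"
          using g(1) by (simp_all add: convex_linear_vimage)
      qed
      have "convex hull A \<subseteq> {x. 0 \<le> g x + c}"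
        using g(2) half(1) by (intro hull_minimal) auto
      then have M_nonneg: "0 \<le> g w + c" if "w \<in> M" for w
        using that M_A hull_subset[of M convex] by blast
      have "g b + c = (\<Sum>w\<in>A. if w = v then 1 else 0) / real (card A)"
        unfolding b_def using barycenter_affine[OF g(1) finite_member[OF A] nonempty[OF A]] g(2) by simp
      then have b_pos: "0 < g b + c"
        using v(1) finite_member[OF A] by (auto simp: card_gt_0_iff)
      \<comment> \<open>The value is an average over \<open>S\<close> of nonnegative numbers, and
        the one at \<open>b\<close> is positive.\<close>
      have "0 < g (barycenter S) + c" if S: "S \<in> E" for S
      proof -
        have S': "finite S" "S \<noteq> {}" "b \<in> S" "S \<subseteq> M"
          using S E(1) G.finite_member[OF E_sd[OF S]] by (auto simp: subset_chain_def)
        then have "0 < (\<Sum>w\<in>S. g w + c)"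
          using b_pos M_nonneg by (intro sum_pos2[of S b]) auto
        then show ?thesis
          unfolding barycenter_affine[OF g(1) S'(1,2)] using S'(1,2) by (simp add: card_gt_0_iff)
      qed
      then have "convex hull B \<subseteq> {x. 0 < g x + c}"
        unfolding B_def using half(2) by (intro hull_minimal) auto
      moreover have "convex hull (A \<inter> T) \<subseteq> {x. g x + c = 0}"
        using g(2) half(3) v(2) by (intro hull_minimal) auto
      moreover have "convex hull B \<inter> convex hull T \<subseteq> convex hull (A \<inter> T)"
        using hull_Int[OF A T(1)] B_A by blast
      ultimately show False
        using T(2) by fastforce
    qed
  qed
qed

end

section \<open>Labels on the second subdivision and the resulting partition\<close>

theorem theorem2p18:
  fixes K :: "'a::euclidean_space set set"
    and Y :: "'b topology"
    and f :: "'a \<Rightarrow> 'b"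
    and n k :: nat
    and V :: "nat \<Rightarrow> 'a set set"
  assumes complex: "simplicial_complex K"
    and dim: "complex_dim K = int n"
    and map: "continuous_map (top_of_set (\<Union>K)) Y f"
    and one_path_component: "\<forall>x\<in>\<Union>K. \<forall>x'\<in>\<Union>K. path_component_of Y (f x) (f x')"
    and k_le: "k \<le> n + 1"
    and V_subcomplex: "\<forall>i\<in>{1..k}. subcomplex (V i) K"
    and V_categorical: "\<forall>i\<in>{1..k}. categorical_set (top_of_set (\<Union>K)) Y f (\<Union>(V i))"
    and V_partition: "is_partition (top_of_set (\<Union>K)) {1..k} (\<lambda>i. \<Union>(V i))"
  shows "\<exists>L P. subdivision L K \<and>
           (\<forall>i\<in>{1..k}. subcomplex (P i) L) \<and>
           (\<forall>i\<in>{1..k}. categorical_set (top_of_set (\<Union>K)) Y f (\<Union>(P i))) \<and>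
           is_partition (top_of_set (\<Union>K)) {1..k} (\<lambda>i. \<Union>(P i)) \<and>
           (\<forall>i\<in>{1..k}. \<exists>Q. subcomplex Q (P i) \<and>
              complex_dim Q = int n - int k + 1 \<and>
              deformation_retracts_onto (\<Union>(P i)) (\<Union>Q))"
proof -
  define X where "X = top_of_set (\<Union>K)"
  define F where "F = scheme_of K"
  interpret F: vertex_scheme F
    unfolding F_def using complex by (rule vertex_scheme_scheme_of)
  interpret F1: vertex_scheme "sd F"
    by (rule F.vertex_scheme_sd)
  interpret F2: vertex_scheme "sd (sd F)"
    by (rule F1.vertex_scheme_sd)
  have real_F: "realization F = \<Union>K"
    unfolding F_def using complex by (rule realization_scheme_of)
  then have real_F2: "realization (sd (sd F)) = \<Union>K"
    by (simp add: F1.realization_sd F.realization_sd)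
  have K_F: "\<exists>S\<in>F. T = convex hull S" if "T \<in> K" "T \<noteq> {}" for T
    unfolding F_def using mem_complex_iff[OF complex] that by blast
  have F_K: "convex hull S \<in> K" if "S \<in> F" for S
    using that by (simp add: F_def scheme_of_def)
  have fin_dims: "finite (insert (- 1) (aff_dim ` K))"
    using complex by (simp add: simplicial_complex_def)
  have card_F: "card S \<le> Suc n" if "S \<in> F" for S
  proof -
    have "aff_dim (convex hull S) \<le> int n"
      using Max_ge[OF fin_dims] F_K[OF that] dim unfolding complex_dim_def by auto
    then show ?thesis
      using F.aff_dim_hull[OF that] by simp
  qed
  obtain A where A: "A \<in> F" "card A = Suc n"
  proof -
    have "int n \<in> insert (- 1) (aff_dim ` K)"
      using Max_in[OF fin_dims] dim unfolding complex_dim_def by simp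
    then obtain T where T: "T \<in> K" "aff_dim T = int n"
      by auto
    then have "T \<noteq> {}"
      by auto
    then obtain S where "S \<in> F" "T = convex hull S"
      using K_F T(1) by blast
    then show thesis
      using that F.aff_dim_hull T(2) by force
  qed
  define T0 where "T0 = convex hull A"
  have T0: "T0 \<in> K" "T0 \<noteq> {}"
    using F_K[OF A(1)] F.nonempty[OF A(1)] by (auto simp: T0_def)
  have cover: "(\<Union>i\<in>{1..k}. \<Union>(V i)) = \<Union>K"
    using V_partition by (simp add: is_partition_def)
  have in_V: "\<exists>i\<in>{1..k}. T \<in> V i" if "T \<in> K" "T \<noteq> {}" for T
    using V_subcomplex that cover by (intro simplex_in_covering_subcomplex[OF complex]) auto
  obtain j0 where j0: "j0 \<in> {1..k}" "T0 \<in> V j0"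
    using in_V[OF T0] by blast
  then have k: "1 \<le> k"
    by auto
  \<comment> \<open>\<open>k_le\<close> makes this subtraction exact; \<open>m\<close> is the
    required dimension \<open>n - k + 1\<close>.\<close>
  define m where "m = Suc n - k"
  have mk: "m + k = Suc n"
    using k_le by (simp add: m_def)

  text \<open>The labels around an interior simplex of \<open>T0\<close> will be raised to \<open>k\<close>, so \<open>T0\<close> has to
    belong to the last member and to no other one.\<close>

  define W where "W j = (if j = k then V j0 else (if j = j0 then V k else V j) - {T0})" for j
  have W_sub: "\<exists>i\<in>{1..k}. W j \<subseteq> V i" if "j \<in> {1..k}" for j
    using that j0 k by (auto simp: W_def)
  have W_K: "W j \<subseteq> K" if "j \<in> {1..k}" for j
    using W_sub[OF that] V_subcomplex by (fastforce simp: subcomplex_def)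
  have W_cat: "categorical_set X Y f (\<Union>(W j))" if "j \<in> {1..k}" for j
    using W_sub[OF that] V_categorical categorical_set_subset[of X Y f _ "\<Union>(W j)"]
    unfolding X_def by (meson Union_mono)
  have W_T0: "T0 \<in> W j \<longleftrightarrow> j = k" if "j \<in> {1..k}" for j
    using j0 by (auto simp: W_def)
  have in_W: "\<exists>j\<in>{1..k}. T \<in> W j" if T: "T \<in> K" "T \<noteq> {}" for T
  proof (cases "T = T0")
    case True
    then show ?thesis
      using W_T0[of k] k by auto
  next
    case False
    obtain i where i: "i \<in> {1..k}" "T \<in> V i"
      using in_V[OF T] by blast
    \<comment> \<open>The index goes through the transposition of \<open>j0\<close> and
      \<open>k\<close> built into \<open>W\<close>.\<close>
    then have "T \<in> W (if i = j0 then k else if i = k then j0 else i)"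
      using False by (auto simp: W_def)
    then show ?thesis
      using i(1) j0(1) k by (intro bexI[of _ "if i = j0 then k else if i = k then j0 else i"]) auto
  qed

  obtain B where B: "B \<in> sd (sd F)" "card B = card A" "convex hull B \<subseteq> convex hull A"
    and B_int: "\<And>T. T \<in> F \<Longrightarrow> convex hull B \<inter> convex hull T \<noteq> {} \<Longrightarrow> A \<subseteq> T"
    using F.interior_simplex[OF A(1)] by blast
  \<comment> \<open>\<open>A\<close> has the largest possible number of vertices, so a simplex whose
    vertices include \<open>A\<close> is \<open>T0\<close> itself.\<close>
  have B_carrier: "T = T0" if T: "T \<in> K" "convex hull B \<inter> T \<noteq> {}" for T
  proof -
    obtain S where S: "S \<in> F" "T = convex hull S"
      using K_F T by blast
    then have "A \<subseteq> S"
      using B_int T(2) by blast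
    then have "A = S"
      using card_F[OF S(1)] A(2) F.finite_member[OF S(1)] by (simp add: card_seteq)
    then show ?thesis
      using S(2) by (simp add: T0_def)
  qed
  have carrier: "\<exists>T\<in>K. convex hull S \<subseteq> T" if S: "S \<in> sd (sd F)" for S
  proof -
    obtain S1 where S1: "S1 \<in> sd F" "convex hull S \<subseteq> convex hull S1"
      using F1.sd_refines[OF S] by blast
    obtain S2 where "S2 \<in> F" "convex hull S1 \<subseteq> convex hull S2"
      using F.sd_refines[OF S1(1)] by blast
    then show ?thesis
      using S1(2) F_K by blast
  qed
  have card_F2: "card S \<le> Suc n" if S: "S \<in> sd (sd F)" for S
  proof -
    obtain T where T: "T \<in> K" "convex hull S \<subseteq> T"
      using carrier[OF S] by blast
    have "aff_dim (convex hull S) \<le> aff_dim T"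
      using T(2) by (rule aff_dim_subset)
    also have "\<dots> \<le> int n"
      using Max_ge[OF fin_dims] T(1) dim unfolding complex_dim_def by auto
    finally show ?thesis
      using F2.aff_dim_hull[OF S] by simp
  qed
  have meets_B: "convex hull S \<subseteq> T0" if S: "S \<in> sd (sd F)" "S \<inter> B \<noteq> {}" for S
  proof -
    obtain T where T: "T \<in> K" "convex hull S \<subseteq> T"
      using carrier[OF S(1)] by blast
    then have "convex hull B \<inter> T \<noteq> {}"
      using S(2) hull_subset[of S convex] hull_subset[of B convex] by blast
    then show ?thesis
      using B_carrier T by blast
  qed

  text \<open>All cofaces of faces of \<open>B\<close> lie in \<open>T0\<close>, so the labels below \<open>B\<close> can be chosen freely;
    with \<open>lvl\<close> every colour occurs on a chain of \<open>m + 1\<close> faces of \<open>B\<close>, whence the dimension of the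
    retracts is exactly \<open>m\<close>.\<close>

  obtain w where w: "bij_betw w {0..<Suc n} B"
    using ex_bij_betw_nat_finite[OF F2.finite_member[OF B(1)]] B(2) A(2) by auto
  have w_inj: "inj_on w {0..<Suc n}" and w_B: "w ` {0..<Suc n} = B"
    using w by (auto simp: bij_betw_def)
  \<comment> \<open>The number of initial vertices of \<open>B\<close>, in the order
    \<open>w\<close>, that \<open>S\<close> contains, capped at \<open>k\<close>. The clause
    \<open>i = 1\<close> is the default that keeps the set nonempty, so that the value lies in
    \<open>{1..k}\<close>.\<close>
  define lvl where "lvl S = Max {i \<in> {1..k}. i = 1 \<or> w ` {0..<i} \<subseteq> S}" for S
  define old where "old S j \<longleftrightarrow> j \<in> {1..k} \<and> (\<exists>T\<in>W j. convex hull S \<subseteq> T)" for S j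
  \<comment> \<open>Simplices that touch \<open>B\<close> without being faces of it get the largest
    label, so monotonicity holds for any monotone choice on the faces of \<open>B\<close>. Away from
    \<open>B\<close> the least index of a carrying \<open>W j\<close> is kept.\<close>
  define J where "J S = (if S \<subseteq> B then lvl S else if S \<inter> B \<noteq> {} then k else (LEAST j. old S j))" for S
  have lvl_in: "lvl S \<in> {i \<in> {1..k}. i = 1 \<or> w ` {0..<i} \<subseteq> S}" for S
    unfolding lvl_def using k by (intro Max_in) auto
  have old_ex: "\<exists>j. old S j" if S: "S \<in> sd (sd F)" for S
  proof -
    obtain T where T: "T \<in> K" "convex hull S \<subseteq> T"
      using carrier[OF S] by blast
    then have "T \<noteq> {}"
      using F2.nonempty[OF S] by auto
    then show ?thesis
      using in_W T unfolding old_def by blast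
  qed
  have old_Least: "old S (LEAST j. old S j)" if "S \<in> sd (sd F)" for S
    using old_ex[OF that] by (rule LeastI_ex)
  have old_range: "j \<in> {1..k}" if "old S j" for S j
    using that by (simp add: old_def)
  have old_antimono: "old S j" if "old T j" "S \<subseteq> T" for S T j
    using that hull_mono[of S T convex] unfolding old_def by blast
  have J_range: "J S \<in> {1..k}" if "S \<in> sd (sd F)" for S
    using lvl_in[of S] old_range[OF old_Least[OF that]] k by (simp add: J_def)
  have J_mono: "J S \<le> J T" if T: "T \<in> sd (sd F)" and ST: "S \<subseteq> T" "S \<noteq> {}" for S T
  proof -
    have S: "S \<in> sd (sd F)"
      using F2.subset_closed[OF T ST] .
    consider "T \<subseteq> B" | "\<not> T \<subseteq> B" "T \<inter> B \<noteq> {}" | "T \<inter> B = {}"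
      by blast
    then show ?thesis
    proof cases
      case 1
      have "lvl S \<le> lvl T"
        unfolding lvl_def[of T] using lvl_in[of S] ST(1) by (intro Max_ge) auto
      then show ?thesis
        using 1 subset_trans[OF ST(1) 1] by (simp add: J_def)
    next
      case 2
      then show ?thesis
        using J_range[OF S] by (simp add: J_def[of T])
    next
      case 3
      then have "S \<inter> B = {}" "\<not> S \<subseteq> B" "\<not> T \<subseteq> B"
        using ST by blast+
      moreover have "old S (LEAST j. old T j)"
        using old_antimono[OF old_Least[OF T] ST(1)] .
      ultimately show ?thesis
        using 3 by (simp add: J_def Least_le)
    qed
  qed

  have flag: "\<exists>D. subset.chain {S \<in> sd (sd F). colour m J S = i} D \<and> card D = Suc m" if i: "i \<in> {1..k}" for i
  proof -
    \<comment> \<open>The first \<open>i\<close> vertices of \<open>B\<close> and \<open>l\<close>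
      further ones from index \<open>k\<close> on. For \<open>i < k\<close> index \<open>i\<close>
      is left out, and for \<open>i = k\<close> the cap applies, so the level remains
      \<open>i\<close>; the cardinality \<open>i + l\<close> keeps \<open>i\<close> in the window
      for all \<open>l \<le> m\<close>.\<close>
    define Z where "Z l = w ` ({0..<i} \<union> {k..<k + l})" for l
    have Z_idx: "{0..<i} \<union> {k..<k + l} \<subseteq> {0..<Suc n}" if "l \<le> m" for l
      using that i mk by auto
    have Z_B: "Z l \<subseteq> B" if "l \<le> m" for l
      unfolding Z_def using Z_idx[OF that] w_B by blast
    have Z_card: "card (Z l) = i + l" if "l \<le> m" for l
    proof -
      have "card (Z l) = card ({0..<i} \<union> {k..<k + l})"
        unfolding Z_def by (rule card_image) (rule inj_on_subset[OF w_inj Z_idx[OF that]])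
      also have "\<dots> = i + l"
        using i by (subst card_Un_disjoint) auto
      finally show ?thesis .
    qed
    have Z_F2: "Z l \<in> sd (sd F)" if "l \<le> m" for l
      using Z_card[OF that] i by (intro F2.subset_closed[OF B(1) Z_B[OF that]]) auto
    have Z_lvl: "lvl (Z l) = i" if l: "l \<le> m" for l
      unfolding lvl_def
    proof (rule Max_eqI)
      show "i \<in> {i \<in> {1..k}. i = 1 \<or> w ` {0..<i} \<subseteq> Z l}"
        using i by (auto simp: Z_def)
      show "j \<le> i" if j: "j \<in> {i \<in> {1..k}. i = 1 \<or> w ` {0..<i} \<subseteq> Z l}" for j
      proof (rule ccontr)
        assume "\<not> j \<le> i"
        then have "i < j" "j \<le> k" "w i \<in> Z l"
          using i j by auto
        then obtain i' where i': "i' \<in> {0..<i} \<union> {k..<k + l}" "w i' = w i"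
          unfolding Z_def by (metis imageE)
        have "i' = i"
          using inj_onD[OF w_inj i'(2)] Z_idx[OF l] i'(1) \<open>i < j\<close> \<open>j \<le> k\<close> k_le by auto
        then show False
          using i'(1) \<open>i < j\<close> \<open>j \<le> k\<close> by auto
      qed
    qed auto
    have "colour m J (Z l) = i" if "l \<le> m" for l
      using Z_lvl[OF that] Z_B[OF that] Z_card[OF that] that by (simp add: colour_def J_def)
    then have "Z ` {0..m} \<subseteq> {S \<in> sd (sd F). colour m J S = i}"
      using Z_F2 by auto
    moreover have "Z l \<subseteq> Z l'" if "l \<le> l'" for l l'
      unfolding Z_def using that by (intro image_mono) auto
    then have "Z l \<subseteq> Z l' \<or> Z l' \<subseteq> Z l" for l l'
      using nat_le_linear by blast
    ultimately have "subset.chain {S \<in> sd (sd F). colour m J S = i} (Z ` {0..m})"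
      unfolding subset_chain_def by blast
    moreover have "inj_on Z {0..m}"
      using Z_card by (intro inj_onI) (metis add_left_cancel atLeastAtMost_iff)
    then have "card (Z ` {0..m}) = Suc m"
      by (simp add: card_image)
    ultimately show ?thesis
      by blast
  qed
  have label_cat: "categorical_set X Y f (realization {S \<in> sd (sd F). J S = j})" if j: "j \<in> {1..k}" for j
  proof (cases "j = k")
    case True
    have "convex hull S \<subseteq> \<Union>(W k)" if S: "S \<in> sd (sd F)" "J S = k" for S
    proof (cases "S \<inter> B = {}")
      case True
      then have "old S k"
        using old_Least[OF S(1)] S(2) F2.nonempty[OF S(1)] by (auto simp: J_def split: if_splits)
      then show ?thesis
        by (auto simp: old_def)
    next
      case False
      then show ?thesis
        using meets_B[OF S(1)] W_T0[of k] k by auto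
    qed
    then have "realization {S \<in> sd (sd F). J S = j} \<subseteq> \<Union>(W k)"
      unfolding realization_def True by blast
    then show ?thesis
      using categorical_set_subset W_cat k by fastforce
  next
    case False
    \<comment> \<open>A simplex of label below \<open>k\<close> is either a face of \<open>B\<close>
      or disjoint from \<open>B\<close>; in the latter case its label is an old one.\<close>
    have "convex hull S \<subseteq> \<Union>(W j) \<union> convex hull B" if S: "S \<in> sd (sd F)" "J S = j" for S
    proof (cases "S \<subseteq> B")
      case True
      then show ?thesis
        using hull_mono by blast
    next
      case not_sub: False
      then have "S \<inter> B = {}"
        using S(2) False by (auto simp: J_def split: if_splits)
      then have "old S j"
        using old_Least[OF S(1)] S(2) not_sub by (auto simp: J_def)
      then show ?thesis
        by (auto simp: old_def)
    qed
    \<comment> \<open>The union is indexed by truth values so that \<open>categorical_set_UN\<close>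
      applies. Its two pieces are disjoint because, among the simplices of \<open>K\<close>, only
      \<open>T0\<close> meets the hull of \<open>B\<close>, and \<open>T0\<close> is not in
      \<open>W j\<close>.\<close>
    then have "realization {S \<in> sd (sd F). J S = j} \<subseteq> (\<Union>b\<in>{True, False}. if b then \<Union>(W j) else convex hull B)"
      unfolding realization_def by fastforce
    moreover have "categorical_set X Y f (\<Union>b\<in>{True, False}. if b then \<Union>(W j) else convex hull B)"
    proof (rule categorical_set_UN)
      have B_K: "convex hull B \<subseteq> \<Union>K"
        using B(3) T0(1) by (auto simp: T0_def)
      have "closed (\<Union>(W j))" "\<Union>(W j) \<subseteq> \<Union>K"
        using W_K[OF j] closed_Union_subcomplex[OF complex] by auto
      then have W_closed: "closedin X (\<Union>(W j))"
        unfolding X_def by (simp add: closed_subset)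
      have B_closed: "closedin X (convex hull B)"
        unfolding X_def using F2.finite_member[OF B(1)] B_K
        by (simp add: closed_subset compact_imp_closed finite_imp_compact_convex_hull)
      have B_cat: "categorical_set X Y f (convex hull B)"
        unfolding X_def by (rule categorical_set_convex[OF map B_K convex_convex_hull])
      have disjoint: "\<Union>(W j) \<inter> convex hull B = {}"
        using B_carrier W_K[OF j] W_T0[OF j] False by blast
      show "closedin X (if b then \<Union>(W j) else convex hull B)" for b
        using W_closed B_closed by simp
      show "categorical_set X Y f (if b then \<Union>(W j) else convex hull B)" for b
        using W_cat[OF j] B_cat by simp
      show "(if b then \<Union>(W j) else convex hull B) \<inter> (if b' then \<Union>(W j) else convex hull B) = {}"
        if "b \<noteq> b'" for b b'
        using disjoint that by auto
    qed (use one_path_component in \<open>auto simp: X_def\<close>)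
    ultimately show ?thesis
      using categorical_set_subset by blast
  qed
  \<comment> \<open>Two subdivisions carry the labels, and \<open>coloured_partition\<close>
    performs two more.\<close>
  have "\<exists>P. (\<forall>i\<in>{1..k}. subcomplex (P i) (complex_of (sd (sd (sd (sd F)))))) \<and>
     (\<forall>i\<in>{1..k}. categorical_set X Y f (\<Union>(P i))) \<and>
     is_partition X {1..k} (\<lambda>i. \<Union>(P i)) \<and>
     (\<forall>i\<in>{1..k}. \<exists>Q. subcomplex Q (P i) \<and> complex_dim Q = int m \<and>
        deformation_retracts_onto (\<Union>(P i)) (\<Union>Q))"
    unfolding X_def real_F2[symmetric]
  proof (rule F2.coloured_partition)
    show "continuous_map (top_of_set (realization (sd (sd F)))) Y f"
      "\<forall>x\<in>realization (sd (sd F)). \<forall>x'\<in>realization (sd (sd F)). path_component_of Y (f x) (f x')"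
      unfolding real_F2 by (fact map, fact one_path_component)
    show "card S \<le> m + k" if "S \<in> sd (sd F)" for S
      unfolding mk using that by (rule card_F2)
    show "categorical_set (top_of_set (realization (sd (sd F)))) Y f (realization {S \<in> sd (sd F). J S = j})"
      if "j \<in> {1..k}" for j
      using label_cat[OF that] by (simp add: X_def real_F2)
  qed (fact J_mono J_range flag)+
  then obtain P where P: "\<forall>i\<in>{1..k}. subcomplex (P i) (complex_of (sd (sd (sd (sd F)))))"
    "\<forall>i\<in>{1..k}. categorical_set X Y f (\<Union>(P i))"
    "is_partition X {1..k} (\<lambda>i. \<Union>(P i))"
    "\<forall>i\<in>{1..k}. \<exists>Q. subcomplex Q (P i) \<and> complex_dim Q = int m \<and>
        deformation_retracts_onto (\<Union>(P i)) (\<Union>Q)"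
    by (elim exE conjE)
  interpret F3: vertex_scheme "sd (sd (sd F))"
    by (rule F2.vertex_scheme_sd)
  interpret F4: vertex_scheme "sd (sd (sd (sd F)))"
    by (rule F3.vertex_scheme_sd)
  have fine_carrier: "\<exists>T\<in>K. convex hull S \<subseteq> T" if S: "S \<in> sd (sd (sd (sd F)))" for S
  proof -
    obtain S1 where S1: "S1 \<in> sd (sd (sd F))" "convex hull S \<subseteq> convex hull S1"
      using F3.sd_refines[OF S] by blast
    obtain S2 where S2: "S2 \<in> sd (sd F)" "convex hull S1 \<subseteq> convex hull S2"
      using F2.sd_refines[OF S1(1)] by blast
    obtain T where "T \<in> K" "convex hull S2 \<subseteq> T"
      using carrier[OF S2(1)] by blast
    then show ?thesis
      using S1(2) S2(2) by (intro bexI[of _ T]) auto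
  qed
  have "\<forall>S\<in>complex_of (sd (sd (sd (sd F)))). \<exists>T\<in>K. S \<subseteq> T"
    using T0(1) fine_carrier by (auto simp: complex_of_def)
  moreover have "\<Union>(complex_of (sd (sd (sd (sd F))))) = \<Union>K"
    by (simp only: Union_complex_of F3.realization_sd F2.realization_sd real_F2)
  ultimately have "subdivision (complex_of (sd (sd (sd (sd F))))) K"
    using F4.simplicial_complex by (simp add: subdivision_def)
  moreover have "int m = int n - int k + 1"
    using mk by linarith
  ultimately show ?thesis
    using P unfolding X_def by (intro exI[of _ "complex_of (sd (sd (sd (sd F))))"] exI[of _ P]) simp
qed

end
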